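(* Let $k\ge1$, $\mu\in\mathbb{R}^k$, and $G_\mu:\mathbb{R}^k\to\mathbb{R}$, $G_\mu(y)=\|y-\mu\|^2$. Then for every integer $j\ge1$ and every $u>0$, $$\widetilde\rho_j(G_\mu,u)=\sum_{i=0}^\infty e^{-\|\mu\|^2/2}\frac{\|\mu\|^{2i}}{2^i\,i!}\,\frac{u^{(k+2i-j)/2}e^{-u/2}}{(2\pi)^{j/2}\Gamma((k+2i)/2)\,2^{(k+2i-2)/2}}\left(\sum_{l=0}^{\lfloor(j-1)/2\rfloor}\sum_{m=0}^{j-1-2l}\mathbb{1}_{\{k\ge j-m-2l-2i\}}\binom{k+2i-1}{j-1-m-2l}\frac{(-1)^{j-1+m+l}(j-1)!}{m!\,l!\,2^l}u^{m+l}\right).$$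
   Context: $\widetilde\rho_j(F,u)$ denotes the $j$-th Euler characteristic (EC) density of the Gaussian-related field $F(y_1,\dots,y_k)$, where $y_i$ are i.i.d. centered unit-variance smooth Gaussian fields. It equals $\widetilde\rho_j(F,u)=(2\pi)^{-j/2}\mathcal{M}_j^{\gamma_{\mathbb{R}^k}}(F^{-1}[u,+\infty))$, where for a domain $D\subset\mathbb{R}^k$, $\mathcal{M}_j^{\gamma_{\mathbb{R}^k}}(D)$ is the coefficient of $r^j/j!$ in the Taylor expansion at $r=0^+$ of $r\mapsto\gamma_{\mathbb{R}^k}(\{x:d(x,D)\le r\})$, and $\gamma_{\mathbb{R}^k}$ is the standard Gaussian measure on $\mathbb{R}^k$. Here $D=\{x:\|x-\mu\|^2\ge u\}$. Convention: $\|\mu\|^{0}=1$ (also when $\mu=0$), and a summand whose indicator vanishes is zero. *)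

theory Defs
  imports "HOL-Probability.Probability" "HOL-Library.Landau_Symbols"
begin

definition std_gaussian :: "(real ^ 'k) measure" where
  "std_gaussian = density lborel (\<lambda>x. ennreal (\<Prod>i\<in>UNIV. std_normal_density (x $ i)))"

(* The set of points at distance at most r from D. The distance to the empty set is infinite,
   whereas infdist x {} = 0; hence the guard. *)
definition tube :: "'a::metric_space set \<Rightarrow> real \<Rightarrow> 'a set" where
  "tube D r = {x. D \<noteq> {} \<and> infdist x D \<le> r}"

(* Taylor expansion of order n at 0+, with Peano remainder; a i is the coefficient of
   r^i / i!. The coefficients are unique whenever such an expansion exists. *)
definition right_taylor_expansion :: "(real \<Rightarrow> real) \<Rightarrow> (nat \<Rightarrow> real) \<Rightarrow> nat \<Rightarrow> bool" where
  "right_taylor_expansion f a n \<longleftrightarrow>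
     (\<lambda>r. f r - (\<Sum>i\<le>n. a i * (r ^ i / fact i))) \<in> o[at_right 0](\<lambda>r. r ^ n)"

definition right_taylor_coeff :: "(real \<Rightarrow> real) \<Rightarrow> nat \<Rightarrow> real" where
  "right_taylor_coeff f n = (THE c. \<exists>a. right_taylor_expansion f a n \<and> a n = c)"

definition gaussian_minkowski :: "nat \<Rightarrow> (real ^ 'k) set \<Rightarrow> real" where
  "gaussian_minkowski j D = right_taylor_coeff (\<lambda>r. measure std_gaussian (tube D r)) j"

(* Euler characteristic density of the field F(y_1, ..., y_k) at level u, where the y_i are
   i.i.d. centered unit-variance smooth Gaussian fields: it depends on F and u only, through
   the Gaussian Minkowski functionals of the excursion domain F^{-1}[u, +infinity). *)
definition ec_density :: "nat \<Rightarrow> (real ^ 'k \<Rightarrow> real) \<Rightarrow> real \<Rightarrow> real" where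
  "ec_density j F u = (2 * pi) powr (- (real j / 2)) * gaussian_minkowski j (F -` {u..})"

definition G :: "real ^ 'k \<Rightarrow> real ^ 'k \<Rightarrow> real" where
  "G \<mu> y = (norm (y - \<mu>))\<^sup>2"

end

theory Submission
  imports Defs
begin

text \<open>
  Write $s = \sqrt u$ and $d$ for the dimension. For $0 < r < s$ the tube of radius $r$ around
  the complement of the open ball of radius $s$ about $\mu$ is the complement of the concentric
  ball of radius $s - r$
  (lemma \<open>tube_outside_ball\<close>). Its Gaussian measure is therefore $1 - K \Phi(s - r)$, where
  $K = (2\pi)^{-d/2} e^{-|\mu|^2/2}$ and $\Phi(t)$ is the integral of
  $e^{-|y|^2/2} e^{-\mu\cdot y}$ over the centred ball of radius $t$; everything reduces to
  expanding $\Phi$ at $s$.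

  The radial factor can be separated without polar coordinates. Let $N(t)$ be the integral of
  $e^{-\mu\cdot y}$ alone over that ball. On a thin annulus $e^{-|y|^2/2}$ is almost constant, so
  $\Phi'(t) = e^{-t^2/2} N'(t)$ (lemma \<open>has_derivative_gaussian_ball\<close>). The reflection
  $y \mapsto -y$ replaces $e^{-\mu\cdot y}$ by $\cosh(\mu\cdot y)$, and the even powers
  $(\mu\cdot y)^{2i}$ are homogeneous; hence $N$ is the power series
  $\sum_i c_i t^{d+2i}$, whose derivatives of every order are computed termwise. This is
  where the series over $i$ in the theorem comes from.

  Up to a factor $(2i)!$ the constants $c_i$ are moments of the unit ball. They follow from the Gaussian moments of
  $\mu\cdot y$: a layer-cake formula turns the Gaussian integral of a homogeneous function
  into its integral over the unit ball times a value of the Gamma function (lemma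
  \<open>nn_integral_gaussian_homogeneous\<close>), while the Gaussian integral of $e^{-t\mu\cdot y}$ is
  known for all $t$ by completing the square, so that its Taylor coefficients can be compared
  (lemma \<open>nn_integral_ball_even_moment\<close>).

  Finally $e^{-(s-r)^2/2} = e^{-u/2}\, e^{-r^2/2}\, e^{sr}$. In the product of the expansions of
  $e^{-r^2/2}$, $e^{sr}$ and $N'(s-r)$ in powers of $r$, the first factor contributes the sum over
  $l$, the second the sum over $m$, and the third the binomial coefficient (lemma
  \<open>measure_tube_Taylor\<close>).
\<close>

section \<open>Expansions at the right of zero with Peano remainder\<close>

text \<open>
  The same notion as \<^const>\<open>right_taylor_expansion\<close>, with plain instead of factorial-scaled
  coefficients, so that products of expansions have the Cauchy product as coefficients.
\<close>

definition peano :: "(real \<Rightarrow> real) \<Rightarrow> (nat \<Rightarrow> real) \<Rightarrow> nat \<Rightarrow> bool" where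
  "peano f a n \<longleftrightarrow> (\<lambda>r. f r - (\<Sum>i\<le>n. a i * r ^ i)) \<in> o[at_right 0](\<lambda>r. r ^ n)"

lemma at_right_pos: "eventually (\<lambda>r::real. 0 < r) (at_right 0)"
  by (simp add: eventually_at_filter)

text \<open>
  The constant term is the limit at zero and therefore vanishes; dividing by the variable then
  lowers the degree by one. This is what makes expansion coefficients unique.
\<close>

lemma polynomial_small_imp_zero:
  fixes d :: "nat \<Rightarrow> real"
  assumes "(\<lambda>r. \<Sum>i\<le>n. d i * r ^ i) \<in> o[at_right 0](\<lambda>r. r ^ n)" and "i \<le> n"
  shows "d i = 0"
  using assms
proof (induction n arbitrary: d i)
  case 0
  then have "((\<lambda>r. d 0 / 1) \<longlongrightarrow> 0) (at_right (0::real))"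
    using smalloD_tendsto by fastforce
  with 0 show ?case
    by (simp add: tendsto_const_iff)
next
  case (Suc n)
  let ?p = "\<lambda>r. \<Sum>i\<le>Suc n. d i * r ^ i"
  have "(\<lambda>r::real. r ^ Suc n) \<in> O[at_right 0](\<lambda>r. 1)"
    by (rule bigoI_tendsto[where c = 0]) (auto intro!: tendsto_eq_intros)
  then have "?p \<in> o[at_right 0](\<lambda>r. 1)"
    using Suc.prems(1) landau_o.small_big_trans by blast
  then have "(?p \<longlongrightarrow> 0) (at_right 0)"
    using smalloD_tendsto by fastforce
  moreover have "(?p \<longlongrightarrow> ?p 0) (at_right 0)"
    by (intro tendsto_intros)
  moreover have "?p 0 = d 0"
    by (subst sum.atMost_shift) simp
  ultimately have d0: "d 0 = 0"
    using tendsto_unique trivial_limit_at_right_real by metis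
  have "?p r = r * (\<Sum>i\<le>n. d (Suc i) * r ^ i)" for r
    by (subst sum.atMost_Suc_shift) (simp add: d0 sum_distrib_left mult_ac)
  with Suc.prems(1) have "(\<lambda>r. r * (\<Sum>i\<le>n. d (Suc i) * r ^ i)) \<in> o[at_right 0](\<lambda>r. r * r ^ n)"
    by simp
  then have "(\<lambda>r. \<Sum>i\<le>n. d (Suc i) * r ^ i) \<in> o[at_right 0](\<lambda>r. r ^ n)"
    by (subst (asm) landau_o.small.mult_cancel_left) (auto simp: eventually_at_filter)
  then have "d (Suc i) = 0" if "i \<le> n" for i
    using Suc.IH[of "\<lambda>i. d (Suc i)"] that by blast
  with d0 Suc.prems(2) show ?case
    by (cases i) auto
qed

lemma peano_unique:
  assumes "peano f a n" and "peano f b n" and "i \<le> n"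
  shows "a i = b i"
proof -
  have "(\<lambda>r. (f r - (\<Sum>i\<le>n. b i * r ^ i)) - (f r - (\<Sum>i\<le>n. a i * r ^ i))) \<in> o[at_right 0](\<lambda>r. r ^ n)"
    using assms(2,1) unfolding peano_def by (rule sum_in_smallo(2))
  then have "(\<lambda>r. \<Sum>i\<le>n. (a i - b i) * r ^ i) \<in> o[at_right 0](\<lambda>r. r ^ n)"
    by (simp add: algebra_simps sum_subtractf)
  from polynomial_small_imp_zero[OF this assms(3)] show ?thesis by simp
qed

lemma peano_cong:
  assumes "eventually (\<lambda>r. f r = g r) (at_right 0)"
  shows "peano f a n \<longleftrightarrow> peano g a n"
  unfolding peano_def by (rule landau_o.small.in_cong) (use assms in eventually_elim, simp)

lemma peano_cmult:
  assumes "peano f a n"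
  shows "peano (\<lambda>r. c * f r) (\<lambda>i. c * a i) n"
proof -
  have "(\<lambda>r. c * (f r - (\<Sum>i\<le>n. a i * r ^ i))) \<in> o[at_right 0](\<lambda>r. r ^ n)"
    using assms unfolding peano_def by simp
  then show ?thesis
    by (simp add: peano_def algebra_simps sum_distrib_left)
qed

lemma power_Suc_smallo: "(\<lambda>r::real. r ^ Suc n) \<in> o[at_right 0](\<lambda>r. r ^ n)"
proof (rule smalloI_tendsto)
  show "((\<lambda>r::real. r ^ Suc n / r ^ n) \<longlongrightarrow> 0) (at_right 0)"
    by (rule Lim_transform_eventually[where f = "\<lambda>r. r"])
       (auto intro!: tendsto_eq_intros simp: eventually_at_filter)
  show "eventually (\<lambda>r::real. r ^ n \<noteq> 0) (at_right 0)"
    using at_right_pos by eventually_elim simp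
qed

text \<open>
  Both functions are bounded near zero, so replacing them by their polynomials costs only
  $o(r^n)$; the product of the polynomials differs from the truncated Cauchy product by finitely
  many monomials of degree greater than $n$.
\<close>

lemma peano_mult:
  assumes f: "peano f a n" and g: "peano g b n"
  shows "peano (\<lambda>r. f r * g r) (\<lambda>i. \<Sum>j\<le>i. a j * b (i - j)) n"
proof -
  let ?A = "\<lambda>r. \<Sum>i\<le>n. a i * r ^ i" and ?B = "\<lambda>r. \<Sum>i\<le>n. b i * r ^ i"
  let ?C = "\<lambda>r. \<Sum>i\<le>n. (\<Sum>j\<le>i. a j * b (i - j)) * r ^ i"
  have bounded: "(\<lambda>r. \<Sum>i\<le>n. c i * r ^ i) \<in> O[at_right 0](\<lambda>r::real. 1)" for c :: "nat \<Rightarrow> real"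
    by (rule bigoI_tendsto[where c = "\<Sum>i\<le>n. c i * 0 ^ i"]) (auto intro!: tendsto_eq_intros)
  have pow1: "(\<lambda>r::real. r ^ n) \<in> O[at_right 0](\<lambda>r. 1)"
    by (rule bigoI_tendsto[where c = "0 ^ n"]) (auto intro!: tendsto_eq_intros)
  have "(\<lambda>r. (f r - ?A r) + ?A r) \<in> O[at_right 0](\<lambda>r. 1)"
    using f bounded[of a] pow1 unfolding peano_def
    by (intro sum_in_bigo(1)) (blast intro: landau_o.big_trans landau_o.small_imp_big)+
  then have f1: "f \<in> O[at_right 0](\<lambda>r. 1)" by simp
  have t1: "(\<lambda>r. f r * (g r - ?B r)) \<in> o[at_right 0](\<lambda>r. 1 * r ^ n)"
    using f1 g unfolding peano_def by (rule landau_o.big_small_mult)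
  have t2: "(\<lambda>r. (f r - ?A r) * ?B r) \<in> o[at_right 0](\<lambda>r. r ^ n * 1)"
    using f bounded[of b] unfolding peano_def by (rule landau_o.small_big_mult)
  have t3: "(\<lambda>r. ?A r * ?B r - ?C r) \<in> o[at_right 0](\<lambda>r. r ^ n)"
  proof -
    let ?I = "{(i, j). i \<le> n \<and> j \<le> n \<and> n < i + j}"
    let ?t = "\<lambda>r (i, j). a i * b j * r ^ (i + j)"
    have fin: "finite ?I"
      by (rule finite_subset[of _ "{..n} \<times> {..n}"]) auto
    have "?A r * ?B r - ?C r = (\<Sum>p\<in>?I. ?t r p)" for r
    proof -
      have "?A r * ?B r = (\<Sum>p\<in>{..n} \<times> {..n}. ?t r p)"
        by (simp add: sum_product sum.cartesian_product power_add mult_ac)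
      also have "{..n} \<times> {..n} = {(i, j). i + j \<le> n} \<union> ?I"
        by auto
      also have "(\<Sum>p\<in>\<dots>. ?t r p) = (\<Sum>p\<in>{(i, j). i + j \<le> n}. ?t r p) + (\<Sum>p\<in>?I. ?t r p)"
        by (rule sum.union_disjoint)
           (auto intro: fin finite_subset[of _ "{..n} \<times> {..n}"])
      also have "(\<Sum>p\<in>{(i, j). i + j \<le> n}. ?t r p) = (\<Sum>k\<le>n. \<Sum>i\<le>k. a i * b (k - i) * r ^ (i + (k - i)))"
        by (rule sum.triangle_reindex_eq)
      also have "\<dots> = ?C r"
        by (auto simp: sum_distrib_right intro!: sum.cong)
      finally show ?thesis by simp
    qed
    moreover have "(\<lambda>r. \<Sum>p\<in>?I. ?t r p) \<in> o[at_right 0](\<lambda>r. r ^ n)"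
    proof (rule big_sum_in_smallo)
      fix p assume "p \<in> ?I"
      then obtain i j where p: "p = (i, j)" "n < i + j" by auto
      define e where "e = i + j - Suc n"
      have e: "i + j = Suc n + e" using p by (simp add: e_def)
      have "(\<lambda>r. a i * b j * r ^ e) \<in> O[at_right 0](\<lambda>r::real. 1)"
        by (rule bigoI_tendsto[where c = "a i * b j * 0 ^ e"]) (auto intro!: tendsto_eq_intros)
      then have "(\<lambda>r. a i * b j * r ^ e * r ^ Suc n) \<in> o[at_right 0](\<lambda>r::real. 1 * r ^ n)"
        using power_Suc_smallo by (rule landau_o.big_small_mult)
      moreover have "r ^ (i + j) = r ^ e * r ^ Suc n" for r :: real
        unfolding e by (simp add: power_add)
      ultimately show "(\<lambda>r. ?t r p) \<in> o[at_right 0](\<lambda>r. r ^ n)"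
        by (simp only: p prod.case mult_1 mult.assoc)
    qed
    ultimately show ?thesis by simp
  qed
  have "(\<lambda>r. f r * (g r - ?B r) + (f r - ?A r) * ?B r + (?A r * ?B r - ?C r))
          \<in> o[at_right 0](\<lambda>r. r ^ n)"
    using sum_in_smallo(1)[OF sum_in_smallo(1)[OF t1[unfolded mult_1] t2[unfolded mult_1_right]] t3]
    by simp
  then show ?thesis
    by (simp add: peano_def algebra_simps)
qed

lemma peano_power_series:
  fixes a :: "nat \<Rightarrow> real"
  assumes "\<And>r. (\<lambda>i. a i * r ^ i) sums f r"
  shows "peano f a n"
proof -
  define S where "S r = (\<Sum>i. a (i + Suc n) * r ^ i)" for r
  have summ: "summable (\<lambda>i. a (i + Suc n) * r ^ i)" for r
  proof (cases "r = 0")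
    case False
    have "summable (\<lambda>i. a (i + Suc n) * r ^ (i + Suc n))"
      using assms sums_summable summable_iff_shift[of "\<lambda>i. a i * r ^ i"] by blast
    then have "summable (\<lambda>i. inverse (r ^ Suc n) * (a (i + Suc n) * r ^ (i + Suc n)))"
      by (rule summable_mult)
    with False show ?thesis by (simp add: power_add field_simps)
  qed (simp add: powser_zero)
  have rem: "f r - (\<Sum>i\<le>n. a i * r ^ i) = S r * r ^ Suc n" for r
  proof -
    have "(\<lambda>i. a (i + Suc n) * r ^ i * r ^ Suc n) sums (S r * r ^ Suc n)"
      unfolding S_def using summ by (intro sums_mult2 summable_sums)
    moreover have "(\<lambda>i. a (i + Suc n) * r ^ (i + Suc n)) sums (f r - (\<Sum>i<Suc n. a i * r ^ i))"
      using assms by (rule sums_split_initial_segment)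
    ultimately show ?thesis
      by (simp only: power_add mult.assoc[symmetric] lessThan_Suc_atMost) (rule sums_unique2)
  qed
  have "isCont S 0"
    unfolding S_def by (rule isCont_powser_converges_everywhere) (rule summ)
  then have "(S \<longlongrightarrow> S 0) (at_right 0)"
    by (simp add: isCont_def filterlim_at_split)
  then have "S \<in> O[at_right 0](\<lambda>r. 1)"
    by (intro bigoI_tendsto[where c = "S 0"]) auto
  then have "(\<lambda>r. S r * r ^ Suc n) \<in> o[at_right 0](\<lambda>r. 1 * r ^ n)"
    using power_Suc_smallo by (rule landau_o.big_small_mult)
  then show ?thesis by (simp only: peano_def rem mult_1)
qed

text \<open>
  L'Hopital's rule applied to the remainder. This is the tool that passes from $\Phi'$, which
  factorizes, to $\Phi$.
\<close>

lemma peano_antiderivative: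
  assumes deriv: "eventually (\<lambda>r. (F has_real_derivative f r) (at r)) (at_right 0)"
    and cont: "(F \<longlongrightarrow> F 0) (at_right 0)"
    and f: "peano f a n"
  shows "peano F (case_nat (F 0) (\<lambda>i. a i / real (Suc i))) (Suc n)"
proof -
  let ?A = "\<lambda>r. \<Sum>i\<le>n. a i / real (Suc i) * r ^ Suc i"
  have dA: "(?A has_real_derivative (\<Sum>i\<le>n. a i * r ^ i)) (at r)" for r
    by (auto intro!: derivative_eq_intros simp del: power_Suc) (simp add: field_simps)
  have "((\<lambda>r. (F r - F 0 - ?A r) / r ^ Suc n) \<longlongrightarrow> 0) (at_right 0)"
  proof (rule lhopital_right_0)
    have "((\<lambda>r. F r - F 0 - ?A r) \<longlongrightarrow> F 0 - F 0 - ?A 0) (at_right 0)"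
      by (intro tendsto_intros cont)
    then show "((\<lambda>r. F r - F 0 - ?A r) \<longlongrightarrow> 0) (at_right 0)" by simp
    show "((\<lambda>r::real. r ^ Suc n) \<longlongrightarrow> 0) (at_right 0)"
      by (auto intro!: tendsto_eq_intros)
    show "eventually (\<lambda>r::real. r ^ Suc n \<noteq> 0) (at_right 0)"
      using at_right_pos by eventually_elim simp
    show "eventually (\<lambda>r::real. real (Suc n) * r ^ n \<noteq> 0) (at_right 0)"
      using at_right_pos by eventually_elim simp
    show "eventually (\<lambda>r. ((\<lambda>r. F r - F 0 - ?A r) has_real_derivative
            f r - (\<Sum>i\<le>n. a i * r ^ i)) (at r)) (at_right 0)"
      using deriv by eventually_elim (auto intro!: derivative_eq_intros dA simp: mult.commute simp del: power_Suc)
    show "eventually (\<lambda>r. ((\<lambda>r. r ^ Suc n) has_real_derivative real (Suc n) * r ^ n) (at r))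
            (at_right 0)"
      by (intro always_eventually allI) (auto intro!: derivative_eq_intros simp del: power_Suc)
    have "((\<lambda>r. (f r - (\<Sum>i\<le>n. a i * r ^ i)) / r ^ n / real (Suc n)) \<longlongrightarrow> 0 / real (Suc n)) (at_right 0)"
      using f unfolding peano_def by (intro tendsto_intros smalloD_tendsto) auto
    then show "((\<lambda>r. (f r - (\<Sum>i\<le>n. a i * r ^ i)) / (real (Suc n) * r ^ n)) \<longlongrightarrow> 0) (at_right 0)"
      by (simp add: field_simps)
  qed
  then have "(\<lambda>r. F r - F 0 - ?A r) \<in> o[at_right 0](\<lambda>r. r ^ Suc n)"
    by (rule smalloI_tendsto) (use at_right_pos in eventually_elim, simp)
  then show ?thesis
    unfolding peano_def by (subst sum.atMost_Suc_shift) (simp add: algebra_simps)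
qed

text \<open>
  Repeated integration of expansions, starting from the continuity of the highest derivative.
\<close>

lemma peano_Taylor:
  assumes "\<And>i r. (D i has_real_derivative D (Suc i) r) (at r)"
  shows "peano (D 0) (\<lambda>i. D i 0 / fact i) n"
  using assms
proof (induction n arbitrary: D)
  case 0
  have "isCont (D 0) 0" using 0 DERIV_isCont by blast
  then have "((\<lambda>r. (D 0 r - D 0 0) / 1) \<longlongrightarrow> (D 0 0 - D 0 0) / 1) (at_right 0)"
    by (intro tendsto_intros) (auto simp: isCont_def filterlim_at_split)
  then have "(\<lambda>r. D 0 r - D 0 0) \<in> o[at_right 0](\<lambda>r. 1)"
    by (intro smalloI_tendsto) auto
  then show ?case by (simp add: peano_def)
next
  case (Suc n)
  have "isCont (D 0) 0" using Suc.prems DERIV_isCont by blast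
  then have "(D 0 \<longlongrightarrow> D 0 0) (at_right 0)"
    by (auto simp: isCont_def filterlim_at_split)
  moreover have "peano (D (Suc 0)) (\<lambda>i. D (Suc i) 0 / fact i) n"
    using Suc.IH[of "\<lambda>i. D (Suc i)"] Suc.prems by blast
  ultimately have "peano (D 0) (case_nat (D 0 0) (\<lambda>i. D (Suc i) 0 / fact i / real (Suc i))) (Suc n)"
    using Suc.prems by (intro peano_antiderivative[of _ "D (Suc 0)"]) auto
  moreover have "case_nat (D 0 0) (\<lambda>i. D (Suc i) 0 / fact i / real (Suc i)) = (\<lambda>i. D i 0 / fact i)"
    by (auto simp: fun_eq_iff simp del: of_nat_Suc split: nat.split)
  ultimately show ?case by simp
qed

lemma right_taylor_expansion_iff_peano:
  "right_taylor_expansion f a n \<longleftrightarrow> peano f (\<lambda>i. a i / fact i) n"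
  by (simp add: right_taylor_expansion_def peano_def)

lemma right_taylor_coeff_eq:
  assumes "peano f a n"
  shows "right_taylor_coeff f n = fact n * a n"
  unfolding right_taylor_coeff_def
proof (rule the_equality)
  show "\<exists>b. right_taylor_expansion f b n \<and> b n = fact n * a n"
    using assms by (intro exI[of _ "\<lambda>i. fact i * a i"]) (simp add: right_taylor_expansion_iff_peano)
next
  fix c assume "\<exists>b. right_taylor_expansion f b n \<and> b n = c"
  then obtain b where "peano f (\<lambda>i. b i / fact i) n" "b n = c"
    by (auto simp: right_taylor_expansion_iff_peano)
  with peano_unique[OF this(1) assms, of n] show "c = fact n * a n"
    by (simp add: field_simps)
qed

section \<open>Tubes around the complement of a ball\<close>

text \<open>
  The distance from a point inside the ball to the outside is realized along the ray from the
  centre through that point; at the centre itself any direction will do.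
\<close>

lemma tube_outside_ball:
  fixes \<mu> :: "real ^ 'k"
  assumes "u > 0" and "0 < r" and "r < sqrt u"
  shows "tube (G \<mu> -` {u..}) r = - ball \<mu> (sqrt u - r)"
proof -
  let ?D = "G \<mu> -` {u..}"
  have D: "?D = {x. sqrt u \<le> norm (x - \<mu>)}"
    using assms(1) real_sqrt_le_iff[of u "(norm (x - \<mu>))\<^sup>2" for x]
    by (auto simp: G_def vimage_def)
  have "closed ?D"
    unfolding D by (intro closed_Collect_le continuous_intros)
  obtain e :: "real ^ 'k" where e: "norm e = 1"
    using vector_choose_size[of 1] by auto
  have nonempty: "?D \<noteq> {}"
  proof -
    have "\<mu> + sqrt u *\<^sub>R e \<in> ?D" using assms(1) e by (simp add: D)
    then show ?thesis by blast
  qed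
  show ?thesis
  proof (rule set_eqI)
    fix x
    define w where "w = norm (x - \<mu>)"
    define v where "v = (if w = 0 then e else (1 / w) *\<^sub>R (x - \<mu>))"
    have v: "norm v = 1" "x = \<mu> + w *\<^sub>R v"
      by (auto simp: v_def w_def e)
    have "infdist x ?D \<le> r \<longleftrightarrow> sqrt u - r \<le> w"
    proof
      assume "infdist x ?D \<le> r"
      moreover obtain y where "y \<in> ?D" "infdist x ?D = dist x y"
        using infdist_attains_inf[OF \<open>closed ?D\<close> nonempty] by blast
      ultimately have "dist x y \<le> r" "sqrt u \<le> dist \<mu> y"
        by (auto simp: D dist_norm norm_minus_commute)
      then show "sqrt u - r \<le> w"
        using dist_triangle[of \<mu> y x] by (simp add: w_def dist_norm norm_minus_commute)
    next
      assume le: "sqrt u - r \<le> w"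
      define y where "y = \<mu> + max w (sqrt u) *\<^sub>R v"
      have "y \<in> ?D" using v assms by (simp add: D y_def)
      moreover have "dist x y = \<bar>w - max w (sqrt u)\<bar>"
        using v by (simp add: y_def dist_norm flip: scaleR_left_diff_distrib)
      ultimately have "infdist x ?D \<le> \<bar>w - max w (sqrt u)\<bar>"
        using infdist_le by metis
      also have "\<dots> \<le> r" using le assms by simp
      finally show "infdist x ?D \<le> r" .
    qed
    then show "x \<in> tube ?D r \<longleftrightarrow> x \<in> - ball \<mu> (sqrt u - r)"
      using nonempty by (auto simp: tube_def w_def dist_norm norm_minus_commute)
  qed
qed

section \<open>Homogeneous and Gaussian weights on Euclidean space\<close>

lemma nn_integral_lborel_affine:
  fixes t :: "'a::euclidean_space"
  assumes [measurable]: "f \<in> borel_measurable borel" and c: "c \<noteq> 0"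
  shows "(\<integral>\<^sup>+x. f x \<partial>lborel) = ennreal (\<bar>c\<bar> ^ DIM('a)) * (\<integral>\<^sup>+x. f (t + c *\<^sub>R x) \<partial>lborel)"
  by (subst lborel_affine[OF c, of t])
     (simp add: nn_integral_density nn_integral_distr nn_integral_cmult)

lemma borel_measurable_indicator_ball_times [measurable]:
  fixes w :: "'a::euclidean_space \<Rightarrow> real"
  assumes "w \<in> borel_measurable borel"
  shows "(\<lambda>x. indicator (ball a s) x * w x) \<in> borel_measurable borel"
  using assms by (intro borel_measurable_times borel_measurable_indicator) auto

lemma nn_integral_ball_homogeneous:
  fixes w :: "'a::euclidean_space \<Rightarrow> real"
  assumes [measurable]: "w \<in> borel_measurable borel"
    and hom: "\<And>c x. 0 < c \<Longrightarrow> w (c *\<^sub>R x) = c ^ p * w x"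
    and s: "0 < s"
  shows "(\<integral>\<^sup>+x. ennreal (indicator (ball 0 s) x * w x) \<partial>lborel) =
         ennreal (s ^ (DIM('a) + p)) * (\<integral>\<^sup>+x. ennreal (indicator (ball 0 1) x * w x) \<partial>lborel)"
proof -
  have "(\<integral>\<^sup>+x. ennreal (indicator (ball 0 s) x * w x) \<partial>lborel) =
        ennreal (s ^ DIM('a)) * (\<integral>\<^sup>+x. ennreal (indicator (ball 0 s) (s *\<^sub>R x) * w (s *\<^sub>R x)) \<partial>lborel)"
    by (subst nn_integral_lborel_affine[where c = s and t = 0], measurable) (use s in auto)
  also have "(\<lambda>x. ennreal (indicator (ball 0 s) (s *\<^sub>R x) * w (s *\<^sub>R x))) =
             (\<lambda>x. ennreal (s ^ p) * ennreal (indicator (ball 0 1) x * w x))"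
    using s by (auto simp: fun_eq_iff hom indicator_def ennreal_mult' split: if_splits)
  also have "(\<integral>\<^sup>+x. ennreal (s ^ p) * ennreal (indicator (ball 0 1) x * w x) \<partial>lborel) =
             ennreal (s ^ p) * (\<integral>\<^sup>+x. ennreal (indicator (ball 0 1) x * w x) \<partial>lborel)"
    by (rule nn_integral_cmult) simp
  finally show ?thesis
    using s by (simp add: power_add ennreal_mult mult.assoc)
qed

text \<open>
  With $a = |x|^2/2$ this writes the Gaussian weight as a superposition of indicators of the open
  balls $|x| < \sqrt{2v}$.
\<close>

lemma exp_layer_cake:
  fixes a :: real
  shows "ennreal (exp (- a)) = (\<integral>\<^sup>+v. ennreal (if a < v then exp (- v) else 0) \<partial>lborel)"
proof -
  have "(\<integral>\<^sup>+v. ennreal (if a < v then exp (- v) else 0) \<partial>lborel) =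
        (\<integral>\<^sup>+v. ennreal (exp (- v)) * indicator {a..} v \<partial>lborel)"
    by (rule nn_integral_cong_AE, use AE_lborel_singleton[of a] in eventually_elim)
       (auto simp: indicator_def)
  also have "\<dots> = ennreal (0 - (- exp (- a)))"
  proof (rule nn_integral_FTC_atLeast)
    show "((\<lambda>v::real. - exp (- v)) \<longlongrightarrow> 0) at_top"
      by real_asymp
  qed (auto intro!: derivative_eq_intros)
  finally show ?thesis by simp
qed

text \<open>
  By Tonelli the Gaussian weight becomes a mixture over $v > 0$, with density $e^{-v}$, of balls of
  radius $\sqrt{2v}$. With $n$ the dimension plus the degree $p$, homogeneity makes the integral
  over such a ball $(2v)^{n/2}$ times the one over the unit ball, and the remaining integral in $v$
  is Euler's integral for $\Gamma(n/2+1)$.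
\<close>

lemma nn_integral_gaussian_homogeneous:
  fixes w :: "'a::euclidean_space \<Rightarrow> real"
  assumes [measurable]: "w \<in> borel_measurable borel"
    and nonneg: "\<And>x. 0 \<le> w x"
    and hom: "\<And>c x. 0 < c \<Longrightarrow> w (c *\<^sub>R x) = c ^ p * w x"
  shows "(\<integral>\<^sup>+x. ennreal (exp (- ((norm x)\<^sup>2 / 2)) * w x) \<partial>lborel) =
         ennreal (2 powr (real (DIM('a) + p) / 2) * Gamma (real (DIM('a) + p) / 2 + 1)) *
         (\<integral>\<^sup>+x. ennreal (indicator (ball 0 1) x * w x) \<partial>lborel)"
    (is "?lhs = _ * ?B")
proof -
  define n where "n = DIM('a) + p"
  have n: "n > 0" by (simp add: n_def)
  have iff: "(norm x)\<^sup>2 / 2 < v \<longleftrightarrow> norm x < sqrt (2 * v)" for x :: 'a and v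
    by (metis norm_ge_zero real_sqrt_abs abs_norm_cancel real_sqrt_less_iff
        divide_less_eq_numeral1(1) mult.commute)
  have "?lhs = (\<integral>\<^sup>+x. \<integral>\<^sup>+v. ennreal (if norm x < sqrt (2 * v) then exp (- v) * w x else 0) \<partial>lborel \<partial>lborel)"
  proof (rule nn_integral_cong)
    fix x :: 'a
    have "ennreal (exp (- ((norm x)\<^sup>2 / 2)) * w x) =
          (\<integral>\<^sup>+v. ennreal (if norm x < sqrt (2 * v) then exp (- v) else 0) \<partial>lborel) * ennreal (w x)"
      by (simp only: exp_layer_cake iff ennreal_mult[OF exp_ge_zero nonneg])
    also have "\<dots> = (\<integral>\<^sup>+v. ennreal (if norm x < sqrt (2 * v) then exp (- v) else 0) * ennreal (w x) \<partial>lborel)"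
      by (rule nn_integral_multc[symmetric]) measurable
    also have "\<dots> = (\<integral>\<^sup>+v. ennreal (if norm x < sqrt (2 * v) then exp (- v) * w x else 0) \<partial>lborel)"
      using nonneg by (intro nn_integral_cong) (auto simp: ennreal_mult)
    finally show "ennreal (exp (- ((norm x)\<^sup>2 / 2)) * w x) = \<dots>" .
  qed
  also have "\<dots> = (\<integral>\<^sup>+v. \<integral>\<^sup>+x. ennreal (if norm x < sqrt (2 * v) then exp (- v) * w x else 0) \<partial>lborel \<partial>lborel)"
    by (rule lborel_pair.Fubini') measurable
  also have "\<dots> = (\<integral>\<^sup>+v. ennreal (2 powr (real n / 2)) *
      ennreal (indicator {0..} v * v powr ((real n / 2 + 1) - 1) / exp v) * ?B \<partial>lborel)"
  proof (rule nn_integral_cong)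
    fix v :: real
    show "(\<integral>\<^sup>+x. ennreal (if norm x < sqrt (2 * v) then exp (- v) * w x else 0) \<partial>lborel) =
      ennreal (2 powr (real n / 2)) * ennreal (indicator {0..} v * v powr ((real n / 2 + 1) - 1) / exp v) * ?B"
    proof (cases "v > 0")
      case True
      have "(\<integral>\<^sup>+x. ennreal (if norm x < sqrt (2 * v) then exp (- v) * w x else 0) \<partial>lborel) =
            (\<integral>\<^sup>+x. ennreal (exp (- v)) * ennreal (indicator (ball 0 (sqrt (2 * v))) x * w x) \<partial>lborel)"
        using nonneg by (intro nn_integral_cong) (auto simp: ennreal_mult indicator_def)
      also have "\<dots> = ennreal (exp (- v)) * (\<integral>\<^sup>+x. ennreal (indicator (ball 0 (sqrt (2 * v))) x * w x) \<partial>lborel)"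
        by (rule nn_integral_cmult) simp
      also have "\<dots> = ennreal (exp (- v)) * (ennreal (sqrt (2 * v) ^ n) * ?B)"
        using True nn_integral_ball_homogeneous[of w p "sqrt (2 * v)"] hom by (simp add: n_def)
      also have "sqrt (2 * v) ^ n = 2 powr (real n / 2) * v powr (real n / 2)"
        using True by (simp add: powr_half_sqrt[symmetric] powr_mult powr_powr flip: powr_realpow)
      also have "ennreal (exp (- v)) * (ennreal (2 powr (real n / 2) * v powr (real n / 2)) * ?B) =
          ennreal (exp (- v) * (2 powr (real n / 2) * v powr (real n / 2))) * ?B"
        by (simp only: ennreal_mult'[OF exp_ge_zero] mult.assoc)
      also have "exp (- v) * (2 powr (real n / 2) * v powr (real n / 2)) =
          2 powr (real n / 2) * (indicator {0..} v * v powr ((real n / 2 + 1) - 1) / exp v)"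
        using True by (simp add: exp_minus field_simps)
      also have "ennreal \<dots> = ennreal (2 powr (real n / 2)) *
          ennreal (indicator {0..} v * v powr ((real n / 2 + 1) - 1) / exp v)"
        by (rule ennreal_mult') simp
      finally show ?thesis .
    next
      case False
      then have "\<not> norm x < sqrt (2 * v)" for x :: 'a
        using norm_ge_zero[of x] real_sqrt_le_0_iff[of "2 * v"] by linarith
      with False show ?thesis using n by (cases "v = 0") (auto simp: indicator_def)
    qed
  qed
  also have "\<dots> = ennreal (2 powr (real n / 2)) *
      (\<integral>\<^sup>+v. ennreal (indicator {0..} v * v powr ((real n / 2 + 1) - 1) / exp v) \<partial>lborel) * ?B"
    by (subst nn_integral_multc, measurable, subst nn_integral_cmult, measurable)
  also have "(\<integral>\<^sup>+v. ennreal (indicator {0..} v * v powr ((real n / 2 + 1) - 1) / exp v) \<partial>lborel) =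
             ennreal (Gamma (real n / 2 + 1))"
    by (subst Gamma_conv_nn_integral_real) auto
  finally show ?thesis
    by (simp add: n_def ennreal_mult')
qed

text \<open>
  The case of degree zero, where the integral over the unit ball is its volume.
\<close>

lemma nn_integral_gaussian:
  "(\<integral>\<^sup>+x. ennreal (exp (- ((norm (x::'a::euclidean_space))\<^sup>2 / 2))) \<partial>lborel) =
   ennreal ((2 * pi) powr (real DIM('a) / 2))"
proof -
  have "(\<integral>\<^sup>+x. ennreal (indicator (ball 0 1) (x::'a)) \<partial>lborel) = ennreal (unit_ball_vol (real DIM('a)))"
    using emeasure_ball[of 1 "0::'a"] by (simp add: ennreal_indicator)
  with nn_integral_gaussian_homogeneous[where w = "\<lambda>_::'a. 1" and p = 0]
  show ?thesis
    by (simp add: unit_ball_vol_def powr_mult Gamma_real_pos less_imp_neq[symmetric] flip: ennreal_mult)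
qed

lemma ennreal_suminf_eqD:
  fixes f :: "nat \<Rightarrow> real"
  assumes "\<And>i. 0 \<le> f i" and "(\<Sum>i. ennreal (f i)) = ennreal x" and "0 \<le> x"
  shows "f sums x"
proof -
  have "summable f"
    using assms by (intro summable_suminf_not_top) auto
  with assms show ?thesis
    by (metis summable_sums suminf_ennreal2 suminf_nonneg ennreal_inj)
qed

lemma cosh_sums: "(\<lambda>i. x ^ (2 * i) / fact (2 * i)) sums cosh (x::real)"
proof -
  have "(\<lambda>n. if even n then x ^ n /\<^sub>R fact n else 0) sums cosh x"
    by (rule cosh_converges)
  then have "(\<lambda>i. if even (2 * i) then x ^ (2 * i) /\<^sub>R fact (2 * i) else 0) sums cosh x"
    by (subst sums_mono_reindex[where g = "\<lambda>i. 2 * i"]) (auto simp: strict_mono_def elim: evenE)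
  then show ?thesis by (simp add: field_simps)
qed

text \<open>
  Averaging with the reflected integrand turns the exponential into a hyperbolic cosine, whose
  power series has nonnegative terms, so that summation and integration commute. It is used for
  two weights: the Gaussian, where it gives a generating function of moments, and the indicator of
  a ball.
\<close>

lemma nn_integral_even_weight_exp:
  fixes \<mu> :: "'a::euclidean_space"
  assumes [measurable]: "h \<in> borel_measurable borel"
    and nonneg: "\<And>y. 0 \<le> h y" and even: "\<And>y. h (- y) = h y"
  shows "(\<integral>\<^sup>+y. ennreal (h y * exp (- (\<mu> \<bullet> y))) \<partial>lborel) =
         (\<Sum>i. ennreal (1 / fact (2 * i)) * (\<integral>\<^sup>+y. ennreal (h y * (\<mu> \<bullet> y) ^ (2 * i)) \<partial>lborel))"
    (is "?I = _")
proof -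
  have "?I = (\<integral>\<^sup>+y. ennreal (h y * exp (\<mu> \<bullet> y)) \<partial>lborel)"
    by (subst nn_integral_lborel_affine[where c = "- 1" and t = 0]) (auto simp: even)
  then have "2 * ?I = (\<integral>\<^sup>+y. ennreal (h y * exp (- (\<mu> \<bullet> y))) \<partial>lborel) +
      (\<integral>\<^sup>+y. ennreal (h y * exp (\<mu> \<bullet> y)) \<partial>lborel)"
    by (simp add: mult_2)
  also have "\<dots> = (\<integral>\<^sup>+y. ennreal (h y * exp (- (\<mu> \<bullet> y))) + ennreal (h y * exp (\<mu> \<bullet> y)) \<partial>lborel)"
    by (rule nn_integral_add[symmetric]) measurable
  also have "\<dots> = (\<integral>\<^sup>+y. 2 * ennreal (h y * cosh (\<mu> \<bullet> y)) \<partial>lborel)"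
  proof (rule nn_integral_cong)
    fix y
    have "ennreal (h y * exp (- (\<mu> \<bullet> y))) + ennreal (h y * exp (\<mu> \<bullet> y)) =
          ennreal (2 * (h y * cosh (\<mu> \<bullet> y)))"
      using nonneg[of y] by (simp add: cosh_def algebra_simps flip: ennreal_plus)
    then show "ennreal (h y * exp (- (\<mu> \<bullet> y))) + ennreal (h y * exp (\<mu> \<bullet> y)) =
          2 * ennreal (h y * cosh (\<mu> \<bullet> y))"
      by (simp add: ennreal_mult')
  qed
  also have "\<dots> = 2 * (\<integral>\<^sup>+y. ennreal (h y * cosh (\<mu> \<bullet> y)) \<partial>lborel)"
    by (rule nn_integral_cmult) (simp add: cosh_def)
  finally have "?I = (\<integral>\<^sup>+y. ennreal (h y * cosh (\<mu> \<bullet> y)) \<partial>lborel)"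
    by (simp add: ennreal_mult_cancel_left)
  also have "\<dots> = (\<integral>\<^sup>+y. (\<Sum>i. ennreal (1 / fact (2 * i)) * ennreal (h y * (\<mu> \<bullet> y) ^ (2 * i))) \<partial>lborel)"
  proof (rule nn_integral_cong)
    fix y
    have s: "(\<lambda>i. 1 / fact (2 * i) * (h y * (\<mu> \<bullet> y) ^ (2 * i))) sums (h y * cosh (\<mu> \<bullet> y))"
      using sums_mult[OF cosh_sums[of "\<mu> \<bullet> y"], of "h y"] by (simp add: mult_ac)
    have pos: "0 \<le> h y * (\<mu> \<bullet> y) ^ (2 * i)" for i
      using nonneg by (simp add: power_mult)
    have "(\<Sum>i. ennreal (1 / fact (2 * i) * (h y * (\<mu> \<bullet> y) ^ (2 * i)))) = ennreal (h y * cosh (\<mu> \<bullet> y))"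
      using s pos by (subst suminf_ennreal2) (auto simp: sums_iff)
    then show "ennreal (h y * cosh (\<mu> \<bullet> y)) =
        (\<Sum>i. ennreal (1 / fact (2 * i)) * ennreal (h y * (\<mu> \<bullet> y) ^ (2 * i)))"
      using pos by (simp only: ennreal_mult'' [OF pos])
  qed
  also have "\<dots> = (\<Sum>i. \<integral>\<^sup>+y. ennreal (1 / fact (2 * i)) * ennreal (h y * (\<mu> \<bullet> y) ^ (2 * i)) \<partial>lborel)"
    by (rule nn_integral_suminf) measurable
  also have "\<dots> = (\<Sum>i. ennreal (1 / fact (2 * i)) * (\<integral>\<^sup>+y. ennreal (h y * (\<mu> \<bullet> y) ^ (2 * i)) \<partial>lborel))"
    by (subst nn_integral_cmult) measurable
  finally show ?thesis .
qed

section \<open>Even moments of the unit ball\<close>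

lemma even_power_series:
  fixes a :: "nat \<Rightarrow> real"
  assumes "(\<lambda>i. a i * r ^ (2 * i)) sums S"
  shows "(\<lambda>n. (if even n then a (n div 2) else 0) * r ^ n) sums S"
proof -
  let ?f = "\<lambda>n. (if even n then a (n div 2) else 0) * r ^ n"
  have "(\<lambda>i. ?f (2 * i)) sums S \<longleftrightarrow> ?f sums S"
    by (rule sums_mono_reindex) (auto simp: strict_mono_def elim!: evenE)
  with assms show ?thesis by simp
qed

text \<open>
  Completing the square: the substitution $y = x - \mu$ removes the linear term.
\<close>

lemma nn_integral_gaussian_exp_linear:
  fixes \<mu> :: "'a::euclidean_space"
  shows "(\<integral>\<^sup>+y. ennreal (exp (- ((norm y)\<^sup>2 / 2)) * exp (- (\<mu> \<bullet> y))) \<partial>lborel) =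
    ennreal ((2 * pi) powr (real DIM('a) / 2) * exp ((norm \<mu>)\<^sup>2 / 2))"
proof -
  have shift: "- ((norm (- \<mu> + x))\<^sup>2 / 2) - \<mu> \<bullet> (- \<mu> + x) = - ((norm x)\<^sup>2 / 2) + (norm \<mu>)\<^sup>2 / 2" for x
    by (simp add: power2_norm_eq_inner inner_add inner_diff inner_commute field_simps)
  let ?f = "\<lambda>y. ennreal (exp (- ((norm y)\<^sup>2 / 2)) * exp (- (\<mu> \<bullet> y)))"
  have "(\<integral>\<^sup>+y. ?f y \<partial>lborel) = (\<integral>\<^sup>+x. ?f (- \<mu> + 1 *\<^sub>R x) \<partial>lborel)"
    by (subst nn_integral_lborel_affine[where c = 1 and t = "- \<mu>"]) auto
  also have "\<dots> = (\<integral>\<^sup>+x. ennreal (exp ((norm \<mu>)\<^sup>2 / 2)) * ennreal (exp (- ((norm (x::'a))\<^sup>2 / 2))) \<partial>lborel)"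
  proof (rule nn_integral_cong)
    fix x :: 'a
    show "?f (- \<mu> + 1 *\<^sub>R x) = ennreal (exp ((norm \<mu>)\<^sup>2 / 2)) * ennreal (exp (- ((norm x)\<^sup>2 / 2)))"
      using shift[of x] by (simp add: exp_add[symmetric] ennreal_mult[symmetric] add.commute)
  qed
  also have "\<dots> = ennreal (exp ((norm \<mu>)\<^sup>2 / 2)) * ennreal ((2 * pi) powr (real DIM('a) / 2))"
    by (simp add: nn_integral_cmult nn_integral_gaussian)
  finally show ?thesis
    by (simp add: ennreal_mult'' mult.commute)
qed

text \<open>
  The coefficient of $s^{d+2i}$ in the integral of $e^{-\mu\cdot y}$ over the ball of radius $s$
  in dimension $d$, where $m = |\mu|$.
\<close>

definition ball_coeff :: "nat \<Rightarrow> real \<Rightarrow> nat \<Rightarrow> real" where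
  "ball_coeff d m i = (2 * pi) powr (real d / 2) * ((m\<^sup>2 / 2) ^ i / fact i) /
     (2 powr (real (d + 2 * i) / 2) * Gamma (real (d + 2 * i) / 2 + 1))"

lemma ball_coeff_nonneg: "0 \<le> ball_coeff d m i"
proof -
  have "0 < Gamma (real (d + 2 * i) / 2 + 1)"
    by (intro Gamma_real_pos) (simp add: add_nonneg_pos)
  then show ?thesis by (simp add: ball_coeff_def)
qed

text \<open>
  Let $g_i$ be the Gaussian integral of $(\mu\cdot y)^{2i}$, which is the moment of the ball up to
  a known Gamma factor. The Gaussian integral of $e^{-t\mu\cdot y}$ equals
  $\sum_i g_i t^{2i}/(2i)!$ and also $(2\pi)^{d/2} e^{t^2|\mu|^2/2}$ for every real $t$, so the
  uniqueness of expansion coefficients determines $g_i$.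
\<close>

lemma nn_integral_ball_even_moment:
  fixes \<mu> :: "'a::euclidean_space"
  shows "(\<integral>\<^sup>+y. ennreal (indicator (ball 0 1) y * (\<mu> \<bullet> y) ^ (2 * i)) \<partial>lborel) =
         ennreal (fact (2 * i) * ball_coeff DIM('a) (norm \<mu>) i)"
proof -
  let ?B = "\<lambda>i. \<integral>\<^sup>+y. ennreal (indicator (ball 0 1) y * (\<mu> \<bullet> y) ^ (2 * i)) \<partial>lborel"
  let ?C = "(2 * pi) powr (real DIM('a) / 2)"
  define b where "b i = enn2real (?B i)" for i
  have b: "?B i = ennreal (b i)" for i
  proof -
    have "?B i \<le> (\<integral>\<^sup>+y. ennreal (norm \<mu> ^ (2 * i)) * indicator (ball 0 1) (y::'a) \<partial>lborel)"
    proof (rule nn_integral_mono)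
      fix y :: 'a
      show "ennreal (indicator (ball 0 1) y * (\<mu> \<bullet> y) ^ (2 * i)) \<le>
            ennreal (norm \<mu> ^ (2 * i)) * indicator (ball 0 1) y"
      proof (cases "y \<in> ball 0 1")
        case True
        have "\<bar>\<mu> \<bullet> y\<bar> \<le> norm \<mu> * norm y" by (rule Cauchy_Schwarz_ineq2)
        also have "\<dots> \<le> norm \<mu> * 1" using True by (intro mult_left_mono) auto
        finally have "\<bar>\<mu> \<bullet> y\<bar> ^ (2 * i) \<le> norm \<mu> ^ (2 * i)" by (intro power_mono) auto
        then show ?thesis using True by (simp add: power_mult)
      qed simp
    qed
    also have "\<dots> = ennreal (norm \<mu> ^ (2 * i)) * emeasure lborel (ball (0::'a) 1)"
      by (rule nn_integral_cmult_indicator) simp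
    also have "\<dots> < \<infinity>"
      using emeasure_lborel_ball_finite[of "0::'a" 1] by (simp add: ennreal_mult_less_top)
    finally show ?thesis by (simp add: b_def less_top)
  qed
  have b_nonneg: "0 \<le> b i" for i by (simp add: b_def)
  define g where "g i = 2 powr (real (DIM('a) + 2 * i) / 2) * Gamma (real (DIM('a) + 2 * i) / 2 + 1) * b i" for i
  have Gamma_pos: "0 < Gamma (real (DIM('a) + 2 * i) / 2 + 1)" for i
    by (intro Gamma_real_pos) (simp add: add_nonneg_pos)
  have g_nonneg: "0 \<le> g i" for i
    unfolding g_def using b_nonneg Gamma_pos[of i] by (intro mult_nonneg_nonneg) auto
  have gauss: "(\<integral>\<^sup>+y. ennreal (exp (- ((norm y)\<^sup>2 / 2)) * (\<mu> \<bullet> y) ^ (2 * i)) \<partial>lborel) = ennreal (g i)" for i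
  proof -
    have "(\<integral>\<^sup>+y. ennreal (exp (- ((norm y)\<^sup>2 / 2)) * (\<mu> \<bullet> y) ^ (2 * i)) \<partial>lborel) =
      ennreal (2 powr (real (DIM('a) + 2 * i) / 2) * Gamma (real (DIM('a) + 2 * i) / 2 + 1)) * ?B i"
      by (rule nn_integral_gaussian_homogeneous) (auto simp: power_mult_distrib power_mult)
    then show ?thesis
      unfolding b g_def by (simp only: ennreal_mult''[OF b_nonneg])
  qed
  have sums1: "(\<lambda>i. g i / fact (2 * i) * t ^ (2 * i)) sums (?C * exp (t\<^sup>2 * (norm \<mu>)\<^sup>2 / 2))" for t :: real
  proof (rule ennreal_suminf_eqD)
    have "ennreal (?C * exp (t\<^sup>2 * (norm \<mu>)\<^sup>2 / 2)) =
       (\<integral>\<^sup>+y. ennreal (exp (- ((norm y)\<^sup>2 / 2)) * exp (- ((t *\<^sub>R \<mu>) \<bullet> y))) \<partial>lborel)"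
      by (subst nn_integral_gaussian_exp_linear) (simp add: power_mult_distrib)
    also have "\<dots> = (\<Sum>i. ennreal (1 / fact (2 * i)) *
       (\<integral>\<^sup>+y. ennreal (exp (- ((norm y)\<^sup>2 / 2)) * ((t *\<^sub>R \<mu>) \<bullet> y) ^ (2 * i)) \<partial>lborel))"
      by (rule nn_integral_even_weight_exp) auto
    also have "\<dots> = (\<Sum>i. ennreal (g i / fact (2 * i) * t ^ (2 * i)))"
    proof (rule suminf_cong)
      fix i
      have "(\<integral>\<^sup>+y. ennreal (exp (- ((norm y)\<^sup>2 / 2)) * ((t *\<^sub>R \<mu>) \<bullet> y) ^ (2 * i)) \<partial>lborel) =
        (\<integral>\<^sup>+y. ennreal (t ^ (2 * i)) * ennreal (exp (- ((norm y)\<^sup>2 / 2)) * (\<mu> \<bullet> y) ^ (2 * i)) \<partial>lborel)"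
        by (intro nn_integral_cong) (simp add: power_mult_distrib power_mult mult_ac flip: ennreal_mult)
      also have "\<dots> = ennreal (t ^ (2 * i)) * ennreal (g i)"
        by (subst nn_integral_cmult) (auto simp: gauss)
      finally show "ennreal (1 / fact (2 * i)) *
         (\<integral>\<^sup>+y. ennreal (exp (- ((norm y)\<^sup>2 / 2)) * ((t *\<^sub>R \<mu>) \<bullet> y) ^ (2 * i)) \<partial>lborel) =
         ennreal (g i / fact (2 * i) * t ^ (2 * i))"
        using g_nonneg[of i] by (simp add: mult_ac power_mult flip: ennreal_mult)
    qed
    finally show "(\<Sum>i. ennreal (g i / fact (2 * i) * t ^ (2 * i))) = ennreal (?C * exp (t\<^sup>2 * (norm \<mu>)\<^sup>2 / 2))" ..
  qed (auto simp: g_nonneg power_mult)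
  have sums2: "(\<lambda>i. ?C * (((norm \<mu>)\<^sup>2 / 2) ^ i / fact i) * t ^ (2 * i)) sums (?C * exp (t\<^sup>2 * (norm \<mu>)\<^sup>2 / 2))"
    for t :: real
  proof -
    have "?C * (((norm \<mu>)\<^sup>2 / 2) ^ i / fact i) * t ^ (2 * i) =
          ?C * ((t\<^sup>2 * (norm \<mu>)\<^sup>2 / 2) ^ i /\<^sub>R fact i)" for i
    proof -
      have "(t\<^sup>2 * (norm \<mu>)\<^sup>2 / 2) ^ i = t ^ (2 * i) * ((norm \<mu>)\<^sup>2 / 2) ^ i"
        by (simp only: power_mult power_mult_distrib times_divide_eq_right[symmetric])
      then show ?thesis
        by (simp only: real_scaleR_def divide_inverse mult_ac)
    qed
    then show ?thesis
      using sums_mult[OF exp_converges[of "t\<^sup>2 * (norm \<mu>)\<^sup>2 / 2"], of ?C] by simp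
  qed
  \<comment> \<open>The expansions are in powers of \<open>t\<close>, so the \<open>i\<close>-th even power is compared at order \<open>2 * i\<close>.\<close>
  have "peano (\<lambda>t. ?C * exp (t\<^sup>2 * (norm \<mu>)\<^sup>2 / 2))
          (\<lambda>n. if even n then g (n div 2) / fact (2 * (n div 2)) else 0) (2 * i)"
    using even_power_series[OF sums1] by (rule peano_power_series)
  moreover have "peano (\<lambda>t. ?C * exp (t\<^sup>2 * (norm \<mu>)\<^sup>2 / 2))
          (\<lambda>n. if even n then ?C * (((norm \<mu>)\<^sup>2 / 2) ^ (n div 2) / fact (n div 2)) else 0) (2 * i)"
    using even_power_series[OF sums2] by (rule peano_power_series)
  ultimately have eq: "g i / fact (2 * i) = ?C * (((norm \<mu>)\<^sup>2 / 2) ^ i / fact i)"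
    by (auto dest: peano_unique[where i = "2 * i"])
  have solve: "y = z * (x / w)" if "w * y / z = x" "0 < w" "0 < z" for w x y z :: real
    using that by (auto simp: field_simps)
  have "b i = fact (2 * i) * ball_coeff DIM('a) (norm \<mu>) i"
    unfolding ball_coeff_def
    by (rule solve[OF eq[unfolded g_def]]) (use Gamma_pos[of i] in auto)
  with b show ?thesis by simp
qed

section \<open>Integrals over balls as functions of the radius\<close>

lemma integrable_continuous_ball:
  fixes f :: "'a::euclidean_space \<Rightarrow> real"
  assumes "continuous_on UNIV f"
  shows "integrable lborel (\<lambda>y. indicator (ball 0 s) y * f y)"
proof -
  have "set_integrable lborel (cball 0 s) f"
    unfolding set_integrable_def
    by (rule borel_integrable_compact) (auto intro: continuous_on_subset[OF assms])
  then have "set_integrable lborel (ball 0 s) f"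
    by (rule set_integrable_subset) auto
  then show ?thesis by (simp add: set_integrable_def)
qed

text \<open>
  Each even power of $\mu\cdot y$ is homogeneous, so its integral over the ball of radius $s$ is a
  power of $s$ times its integral over the unit ball.
\<close>

lemma integral_ball_exp_sums:
  fixes \<mu> :: "'a::euclidean_space"
  assumes s: "0 < s"
  shows "(\<lambda>i. ball_coeff DIM('a) (norm \<mu>) i * s ^ (DIM('a) + 2 * i)) sums
         (LINT y|lborel. indicator (ball 0 s) y * exp (- (\<mu> \<bullet> y)))"
proof (rule ennreal_suminf_eqD)
  have int: "integrable lborel (\<lambda>y. indicator (ball 0 s) y * exp (- (\<mu> \<bullet> y)))"
    by (intro integrable_continuous_ball continuous_intros)
  have "ennreal (LINT y|lborel. indicator (ball 0 s) y * exp (- (\<mu> \<bullet> y))) =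
        (\<integral>\<^sup>+y. ennreal (indicator (ball 0 s) y * exp (- (\<mu> \<bullet> y))) \<partial>lborel)"
    using int by (rule nn_integral_eq_integral[symmetric]) auto
  also have "\<dots> = (\<Sum>i. ennreal (1 / fact (2 * i)) *
      (\<integral>\<^sup>+y. ennreal (indicator (ball 0 s) y * (\<mu> \<bullet> y) ^ (2 * i)) \<partial>lborel))"
    by (rule nn_integral_even_weight_exp) (auto simp: indicator_def)
  also have "\<dots> = (\<Sum>i. ennreal (ball_coeff DIM('a) (norm \<mu>) i * s ^ (DIM('a) + 2 * i)))"
  proof (rule suminf_cong)
    fix i
    have "(\<integral>\<^sup>+y. ennreal (indicator (ball 0 s) y * (\<mu> \<bullet> y) ^ (2 * i)) \<partial>lborel) =
      ennreal (s ^ (DIM('a) + 2 * i)) * ennreal (fact (2 * i) * ball_coeff DIM('a) (norm \<mu>) i)"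
      unfolding nn_integral_ball_even_moment[symmetric]
      by (rule nn_integral_ball_homogeneous) (auto simp: power_mult_distrib s)
    then show "ennreal (1 / fact (2 * i)) *
       (\<integral>\<^sup>+y. ennreal (indicator (ball 0 s) y * (\<mu> \<bullet> y) ^ (2 * i)) \<partial>lborel) =
       ennreal (ball_coeff DIM('a) (norm \<mu>) i * s ^ (DIM('a) + 2 * i))"
      using s ball_coeff_nonneg[of "DIM('a)" "norm \<mu>" i]
      by (simp add: mult_ac flip: ennreal_mult)
  qed
  finally show "(\<Sum>i. ennreal (ball_coeff DIM('a) (norm \<mu>) i * s ^ (DIM('a) + 2 * i))) =
    ennreal (LINT y|lborel. indicator (ball 0 s) y * exp (- (\<mu> \<bullet> y)))" ..
qed (use s in \<open>auto simp: ball_coeff_nonneg intro!: integral_nonneg_AE\<close>)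

text \<open>
  On the annulus between the radii $a$ and $b$ the Gaussian factor lies between its values at
  $b$ and at $a$.
\<close>

lemma gaussian_weight_annulus:
  fixes w :: "'a::euclidean_space \<Rightarrow> real"
  assumes cont: "continuous_on UNIV w" and nonneg: "\<And>y. 0 \<le> w y" and ab: "0 \<le> a" "a \<le> b"
  defines "N \<equiv> \<lambda>s. LINT y|lborel. indicator (ball 0 s) y * w y"
    and "\<Phi> \<equiv> \<lambda>s. LINT y|lborel. indicator (ball 0 s) y * (exp (- ((norm y)\<^sup>2 / 2)) * w y)"
  shows "exp (- (b\<^sup>2 / 2)) * (N b - N a) \<le> \<Phi> b - \<Phi> a"
    and "\<Phi> b - \<Phi> a \<le> exp (- (a\<^sup>2 / 2)) * (N b - N a)"
proof -
  let ?E = "\<lambda>y::'a. exp (- ((norm y)\<^sup>2 / 2))"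
  let ?I = "\<lambda>y. indicator (ball 0 b) y - indicator (ball (0::'a) a) y :: real"
  have int: "integrable lborel (\<lambda>y. indicator (ball 0 s) y * w y)"
       "integrable lborel (\<lambda>y. indicator (ball 0 s) y * (?E y * w y))" for s
    by (auto intro!: integrable_continuous_ball continuous_intros cont)
  have N: "c * (N b - N a) = (LINT y|lborel. ?I y * (c * w y))"
    and intN: "integrable lborel (\<lambda>y. ?I y * (c * w y))" for c
  proof -
    have eq: "?I y * (c * w y) = c * (indicator (ball 0 b) y * w y - indicator (ball 0 a) y * w y)" for y
      by (simp add: algebra_simps)
    show "c * (N b - N a) = (LINT y|lborel. ?I y * (c * w y))"
      unfolding eq N_def by (subst integral_mult_right_zero) (simp add: int)
    show "integrable lborel (\<lambda>y. ?I y * (c * w y))"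
      unfolding eq by (intro integrable_mult_right Bochner_Integration.integrable_diff int)
  qed
  have Phi: "\<Phi> b - \<Phi> a = (LINT y|lborel. ?I y * (?E y * w y))"
    unfolding \<Phi>_def by (simp add: left_diff_distrib int)
  have intPhi: "integrable lborel (\<lambda>y. ?I y * (?E y * w y))"
    by (simp add: left_diff_distrib int)
  have bounds: "?I y * (exp (- (b\<^sup>2 / 2)) * w y) \<le> ?I y * (?E y * w y) \<and>
      ?I y * (?E y * w y) \<le> ?I y * (exp (- (a\<^sup>2 / 2)) * w y)" for y
  proof (cases "a \<le> norm y \<and> norm y < b")
    case True
    then have "exp (- (b\<^sup>2 / 2)) \<le> ?E y" "?E y \<le> exp (- (a\<^sup>2 / 2))"
      using ab by (auto intro!: power_mono)
    then show ?thesis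
      using True nonneg by (auto simp: indicator_def intro!: mult_right_mono)
  next
    case False
    then have "?I y = 0" using ab by (auto simp: indicator_def)
    then show ?thesis by simp
  qed
  show "exp (- (b\<^sup>2 / 2)) * (N b - N a) \<le> \<Phi> b - \<Phi> a"
    unfolding N Phi using bounds by (intro integral_mono intN intPhi) auto
  show "\<Phi> b - \<Phi> a \<le> exp (- (a\<^sup>2 / 2)) * (N b - N a)"
    unfolding N Phi using bounds by (intro integral_mono intN intPhi) auto
qed

text \<open>
  The bounds on thin annuli squeeze the difference quotient of the Gaussian integral between
  multiples of the unweighted one, and both multipliers tend to $e^{-s^2/2}$. This takes the place
  of integration in polar coordinates.
\<close>

lemma has_derivative_gaussian_ball:
  fixes w :: "'a::euclidean_space \<Rightarrow> real"
  assumes cont: "continuous_on UNIV w" and nonneg: "\<And>y. 0 \<le> w y" and s: "0 < s"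
    and deriv: "((\<lambda>s. LINT y|lborel. indicator (ball 0 s) y * w y) has_real_derivative D) (at s)"
  shows "((\<lambda>s. LINT y|lborel. indicator (ball 0 s) y * (exp (- ((norm y)\<^sup>2 / 2)) * w y))
           has_real_derivative exp (- (s\<^sup>2 / 2)) * D) (at s)"
proof -
  define N where "N = (\<lambda>s. LINT y|lborel. indicator (ball 0 s) y * w y)"
  define \<Phi> where "\<Phi> = (\<lambda>s. LINT y|lborel. indicator (ball 0 s) y * (exp (- ((norm y)\<^sup>2 / 2)) * w y))"
  define Q where "Q t = (N t - N s) / (t - s)" for t
  have Q: "(Q \<longlongrightarrow> D) (at s)"
    using deriv unfolding Q_def N_def[symmetric] by (simp add: has_field_derivative_iff)
  have ev: "eventually (\<lambda>t. 0 < t) (at s)"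
    using s by (intro order_tendstoD(1)[OF tendsto_ident_at])
  have bounds: "exp (- ((max s t)\<^sup>2 / 2)) * Q t \<le> (\<Phi> t - \<Phi> s) / (t - s) \<and>
      (\<Phi> t - \<Phi> s) / (t - s) \<le> exp (- ((min s t)\<^sup>2 / 2)) * Q t" if "0 < t" "t \<noteq> s" for t
  proof (cases "s < t")
    case True
    with gaussian_weight_annulus[OF cont nonneg, of s t] s
    show ?thesis by (simp add: Q_def N_def \<Phi>_def divide_right_mono)
  next
    case False
    have eq: "Q t = (N s - N t) / (s - t)" "(\<Phi> t - \<Phi> s) / (t - s) = (\<Phi> s - \<Phi> t) / (s - t)"
      using that by (auto simp: Q_def field_simps)
    from False gaussian_weight_annulus[OF cont nonneg, of t s] that
    show ?thesis unfolding eq by (simp add: N_def \<Phi>_def divide_right_mono)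
  qed
  have "((\<lambda>t. (\<Phi> t - \<Phi> s) / (t - s)) \<longlongrightarrow> exp (- (s\<^sup>2 / 2)) * D) (at s)"
  proof (rule tendsto_sandwich)
    show "eventually (\<lambda>t. exp (- ((max s t)\<^sup>2 / 2)) * Q t \<le> (\<Phi> t - \<Phi> s) / (t - s)) (at s)"
      using ev eventually_neq_at_within by eventually_elim (use bounds in auto)
    show "eventually (\<lambda>t. (\<Phi> t - \<Phi> s) / (t - s) \<le> exp (- ((min s t)\<^sup>2 / 2)) * Q t) (at s)"
      using ev eventually_neq_at_within by eventually_elim (use bounds in auto)
    show "((\<lambda>t. exp (- ((max s t)\<^sup>2 / 2)) * Q t) \<longlongrightarrow> exp (- (s\<^sup>2 / 2)) * D) (at s)"
      by (auto intro!: tendsto_eq_intros Q)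
    show "((\<lambda>t. exp (- ((min s t)\<^sup>2 / 2)) * Q t) \<longlongrightarrow> exp (- (s\<^sup>2 / 2)) * D) (at s)"
      by (auto intro!: tendsto_eq_intros Q)
  qed
  then show ?thesis
    unfolding \<Phi>_def[symmetric] by (simp add: has_field_derivative_iff)
qed

lemma diffs_funpow:
  fixes C :: "nat \<Rightarrow> real"
  shows "(diffs ^^ k) C q = fact k * real ((q + k) choose k) * C (q + k)"
proof (induction k arbitrary: q)
  case (Suc k)
  have falling: "fact k * real ((q + k) choose k) = fact (q + k) / fact q" for q k
    by (simp add: binomial_fact)
  have "real (Suc q) * (fact k * real ((Suc q + k) choose k)) = fact (Suc k) * real ((q + Suc k) choose Suc k)"
    unfolding falling by (simp del: of_nat_Suc)
  with Suc show ?case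
    by (simp add: diffs_def mult.assoc[symmetric] del: of_nat_Suc fact_Suc binomial_Suc_Suc)
qed simp

text \<open>
  A series in the powers $s^{d+2i}$ is an everywhere convergent power series with gaps. Its
  termwise derivatives are therefore derivatives on the whole line, also beyond the positive
  half-line on which the sum is known to be $N$; this spares all uniform convergence arguments.
\<close>

lemma gap_series_derivatives:
  fixes c :: "nat \<Rightarrow> real"
  assumes sums: "\<And>s. 0 < s \<Longrightarrow> (\<lambda>i. c i * s ^ (d + 2 * i)) sums N s"
  obtains T :: "nat \<Rightarrow> real \<Rightarrow> real" where
    "\<And>k s. (T k has_real_derivative T (Suc k) s) (at s)"
    and "\<And>s. 0 < s \<Longrightarrow> T 0 s = N s"
    and "\<And>k s. 0 < s \<Longrightarrow>
      (\<lambda>i. fact k * real ((d + 2 * i) choose k) * c i * s ^ (d + 2 * i - k)) sums T k s"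
proof -
  define C where "C q = (if d \<le> q \<and> even (q - d) then c ((q - d) div 2) else 0)" for q
  have C: "C (d + 2 * i) = c i" for i by (simp add: C_def)
  have gap: "C q = 0" if "q \<notin> range (\<lambda>i. d + 2 * i)" for q
  proof (rule ccontr)
    assume "C q \<noteq> 0"
    then have "d \<le> q" "even (q - d)" by (auto simp: C_def split: if_splits)
    then have "q = d + 2 * ((q - d) div 2)" by simp
    with that show False by blast
  qed
  have mono: "strict_mono (\<lambda>i. d + 2 * i)" by (simp add: strict_mono_def)
  have Csums: "(\<lambda>q. C q * s ^ q) sums N s" if "0 < s" for s
    using sums[OF that] sums_mono_reindex[OF mono, of "\<lambda>q. C q * s ^ q" "N s"] gap by (simp add: C)
  have summable: "summable (\<lambda>q. (diffs ^^ k) C q * s ^ q)" for k s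
  proof (induction k arbitrary: s)
    case 0
    have "summable (\<lambda>q. C q * (\<bar>s\<bar> + 1) ^ q)"
      using Csums[of "\<bar>s\<bar> + 1"] by (simp add: sums_iff)
    then have "summable (\<lambda>q. C q * s ^ q)"
      by (rule powser_inside) simp
    then show ?case by simp
  next
    case (Suc k)
    have "summable (\<lambda>q. diffs ((diffs ^^ k) C) q * s ^ q)"
      by (rule termdiff_converges_all) (rule Suc)
    then show ?case by simp
  qed
  define T where "T k s = (\<Sum>q. (diffs ^^ k) C q * s ^ q)" for k s
  show thesis
  proof
    show "(T k has_real_derivative T (Suc k) s) (at s)" for k s
      unfolding T_def using termdiffs_strong_converges_everywhere[OF summable, of k s] by simp
    show "T 0 s = N s" if "0 < s" for s
      using Csums[OF that] by (simp add: T_def sums_iff)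
    show "(\<lambda>i. fact k * real ((d + 2 * i) choose k) * c i * s ^ (d + 2 * i - k)) sums T k s"
      if "0 < s" for k s
    proof -
      let ?g = "\<lambda>q. fact k * real (q choose k) * C q * s ^ (q - k)"
      have "(\<lambda>q. ?g (q + k)) sums T k s"
        using summable[of k s] unfolding T_def by (simp add: diffs_funpow summable_sums)
      then have "?g sums (T k s + (\<Sum>q<k. ?g q))"
        by (rule iffD1[OF sums_iff_shift])
      also have "(\<Sum>q<k. ?g q) = 0" by (intro sum.neutral) auto
      finally have "?g sums T k s" by simp
      then have "(\<lambda>i. ?g (d + 2 * i)) sums T k s"
        by (subst sums_mono_reindex[OF mono]) (auto simp: gap)
      then show ?thesis by (simp only: C)
    qed
  qed
qed

section \<open>The standard Gaussian measure of a ball\<close>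

lemma prod_std_normal_density:
  "(\<Prod>i\<in>UNIV. std_normal_density ((x::real ^ 'k) $ i)) =
   (2 * pi) powr - (real CARD('k) / 2) * exp (- ((norm x)\<^sup>2 / 2))"
proof -
  have "(\<Prod>i\<in>UNIV. std_normal_density (x $ i)) =
        (1 / sqrt (2 * pi)) ^ CARD('k) * exp (\<Sum>i\<in>UNIV. - ((x $ i)\<^sup>2 / 2))"
    by (simp add: std_normal_density_def prod_dividef exp_sum power_divide)
  also have "(\<Sum>i\<in>UNIV. - ((x $ i)\<^sup>2 / 2)) = - ((norm x)\<^sup>2 / 2)"
    by (simp add: norm_vec_def L2_set_def sum_nonneg sum_negf flip: sum_divide_distrib)
  also have "(1 / sqrt (2 * pi)) ^ CARD('k) = (2 * pi) powr - (real CARD('k) / 2)"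
    by (simp add: powr_half_sqrt[symmetric] powr_minus_divide powr_powr power_divide powr_power)
  finally show ?thesis .
qed

lemma emeasure_std_gaussian:
  fixes A :: "(real ^ 'k) set"
  assumes [measurable]: "A \<in> sets borel"
  shows "emeasure std_gaussian A =
    ennreal ((2 * pi) powr - (real CARD('k) / 2)) *
    (\<integral>\<^sup>+x. ennreal (indicator A x * exp (- ((norm x)\<^sup>2 / 2))) \<partial>lborel)"
proof -
  have "emeasure std_gaussian A =
    (\<integral>\<^sup>+x. ennreal ((2 * pi) powr - (real CARD('k) / 2) * exp (- ((norm x)\<^sup>2 / 2))) * indicator A x \<partial>lborel)"
    unfolding std_gaussian_def prod_std_normal_density by (subst emeasure_density) auto
  also have "\<dots> = (\<integral>\<^sup>+x. ennreal ((2 * pi) powr - (real CARD('k) / 2)) *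
      ennreal (indicator A x * exp (- ((norm x)\<^sup>2 / 2))) \<partial>lborel)"
    by (intro nn_integral_cong) (auto simp: indicator_def ennreal_mult')
  also have "\<dots> = ennreal ((2 * pi) powr - (real CARD('k) / 2)) *
    (\<integral>\<^sup>+x. ennreal (indicator A x * exp (- ((norm x)\<^sup>2 / 2))) \<partial>lborel)"
    by (rule nn_integral_cmult) measurable
  finally show ?thesis .
qed

lemma sets_std_gaussian [simp]: "sets std_gaussian = sets borel"
  and space_std_gaussian [simp]: "space std_gaussian = UNIV"
  by (simp_all add: std_gaussian_def)

lemma prob_space_std_gaussian: "prob_space (std_gaussian :: (real ^ 'k) measure)"
proof
  have "emeasure std_gaussian (UNIV :: (real ^ 'k) set) = 1"
    by (subst emeasure_std_gaussian)
       (auto simp: nn_integral_gaussian powr_minus field_simps simp flip: ennreal_mult)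
  then show "emeasure std_gaussian (space (std_gaussian :: (real ^ 'k) measure)) = 1"
    by simp
qed

text \<open>
  Translating the ball to the origin turns the Gaussian density into a constant times
  $e^{-|y|^2/2} e^{-\mu\cdot y}$.
\<close>

lemma measure_std_gaussian_ball:
  fixes \<mu> :: "real ^ 'k"
  shows "measure std_gaussian (ball \<mu> s) =
    (2 * pi) powr - (real CARD('k) / 2) * exp (- ((norm \<mu>)\<^sup>2 / 2)) *
    (LINT y|lborel. indicator (ball 0 s) y * (exp (- ((norm y)\<^sup>2 / 2)) * exp (- (\<mu> \<bullet> y))))"
    (is "_ = ?c * ?m * ?I")
proof -
  let ?f = "\<lambda>x. ennreal (indicator (ball \<mu> s) x * exp (- ((norm x)\<^sup>2 / 2)))"
  let ?g = "\<lambda>y. indicator (ball 0 s) y * (exp (- ((norm y)\<^sup>2 / 2)) * exp (- (\<mu> \<bullet> y)))"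
  have int: "integrable lborel ?g"
    by (auto intro!: integrable_continuous_ball continuous_intros)
  have shift: "exp (- ((norm (\<mu> + y))\<^sup>2 / 2)) = ?m * (exp (- ((norm y)\<^sup>2 / 2)) * exp (- (\<mu> \<bullet> y)))" for y
    unfolding exp_add[symmetric]
    by (simp add: power2_norm_eq_inner inner_add inner_commute field_simps)
  have I_nonneg: "0 \<le> ?I" by (auto intro!: integral_nonneg_AE)
  have "(\<integral>\<^sup>+x. ?f x \<partial>lborel) = (\<integral>\<^sup>+y. ?f (\<mu> + 1 *\<^sub>R y) \<partial>lborel)"
    by (subst nn_integral_lborel_affine[where c = 1 and t = \<mu>]) auto
  also have "\<dots> = (\<integral>\<^sup>+y. ennreal (?m * ?g y) \<partial>lborel)"
    by (intro nn_integral_cong) (auto simp: shift indicator_def dist_norm)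
  also have "\<dots> = ennreal (LINT y|lborel. ?m * ?g y)"
    by (rule nn_integral_eq_integral) (use int in auto)
  also have "(LINT y|lborel. ?m * ?g y) = ?m * ?I"
    by (rule integral_mult_right_zero)
  finally have "emeasure std_gaussian (ball \<mu> s) = ennreal (?c * ?m * ?I)"
    by (subst emeasure_std_gaussian) (auto simp: ennreal_mult' mult.assoc)
  then show ?thesis
    using I_nonneg by (simp add: measure_def)
qed

section \<open>The Euler characteristic densities\<close>

text \<open>
  The Gamma factor in \<^const>\<open>ball_coeff\<close> has argument $(d+2i)/2+1$; the factor $d+2i$ that
  appears on differentiating $s^{d+2i}$ lowers it by one, which gives the normalization of the
  chi density with $d+2i$ degrees of freedom, weighted by a Poisson probability up to the factor
  $e^{-m^2/2}$.
\<close>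

lemma ball_coeff_times_degree:
  assumes "0 < d"
  shows "(2 * pi) powr - (real d / 2) * (real (d + 2 * i) * ball_coeff d m i) =
    m ^ (2 * i) / (2 ^ i * fact i) /
      (Gamma ((real d + 2 * real i) / 2) * 2 powr ((real d + 2 * real i - 2) / 2))"
proof -
  define h where "h = (real d + 2 * real i) / 2"
  have h: "0 < h" using assms by (simp add: h_def add_pos_nonneg)
  have Gamma_h: "Gamma (h + 1) = h * Gamma h" "0 < Gamma h"
    using h by (auto intro!: Gamma_plus1 Gamma_real_pos dest: nonpos_Ints_nonpos)
  have e: "real (d + 2 * i) = 2 * h" "(real d + 2 * real i - 2) / 2 = h - 1"
    and e2: "2 * h / 2 = h"
    by (simp_all add: h_def field_simps)
  have p: "(2 * pi) powr - (real d / 2) * (2 * pi) powr (real d / 2) = 1"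
    by (simp flip: powr_add)
  have "(2 * pi) powr - (real d / 2) * (real (d + 2 * i) * ball_coeff d m i) =
    ((2 * pi) powr - (real d / 2) * (2 * pi) powr (real d / 2)) *
      (2 * h * ((m\<^sup>2 / 2) ^ i / fact i) / (2 powr h * (h * Gamma h)))"
    by (simp only: ball_coeff_def e e2 Gamma_h) (simp only: divide_inverse mult_ac)
  also have "\<dots> = m ^ (2 * i) / (2 ^ i * fact i) / (Gamma h * 2 powr (h - 1))"
    using h Gamma_h(2) unfolding p power_mult[of m 2 i]
    by (simp add: powr_diff power_divide mult_ac)
  finally show ?thesis by (simp add: e h_def)
qed

lemma sum_atMost_even:
  fixes f :: "nat \<Rightarrow> nat \<Rightarrow> 'a::comm_monoid_add"
  shows "(\<Sum>p\<le>q. if even p then f (p div 2) p else 0) = (\<Sum>l = 0..q div 2. f l (2 * l))"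
proof -
  have "(\<Sum>p\<le>q. if even p then f (p div 2) p else 0) = (\<Sum>p\<in>(\<lambda>l. 2 * l) ` {0..q div 2}. f (p div 2) p)"
    by (rule sum.mono_neutral_cong_right) (auto elim!: evenE)
  also have "\<dots> = (\<Sum>l = 0..q div 2. f l (2 * l))"
    by (subst sum.reindex) (auto simp: inj_on_def)
  finally show ?thesis .
qed

text \<open>
  Here \<open>T k\<close> stands for the \<open>k\<close>-th derivative of the unweighted integral over the ball. The
  derivative of the measure of the tube factorizes as
  $K e^{-u/2} \cdot e^{-r^2/2} \cdot e^{\sqrt u\, r} \cdot T_1(\sqrt u - r)$, and the coefficients
  are those of the Cauchy product; the gaps in the series of the Gaussian factor leave the sum
  over the even indices $2l$.
\<close>

lemma measure_tube_Taylor: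
  fixes \<mu> :: "real ^ 'k" and T :: "nat \<Rightarrow> real \<Rightarrow> real"
  assumes u: "0 < u"
    and T: "\<And>k s. (T k has_real_derivative T (Suc k) s) (at s)"
    and T0: "\<And>s. 0 < s \<Longrightarrow> T 0 s = (LINT y|lborel. indicator (ball 0 s) y * exp (- (\<mu> \<bullet> y)))"
  defines "K \<equiv> (2 * pi) powr - (real CARD('k) / 2) * exp (- ((norm \<mu>)\<^sup>2 / 2))"
  obtains a where "peano (\<lambda>r. measure std_gaussian (tube (G \<mu> -` {u..}) r)) a (Suc q)"
    and "fact (Suc q) * a (Suc q) = K * exp (- (u / 2)) * fact q *
      (\<Sum>l = 0..q div 2. (- 1 / 2) ^ l / fact l *
        (\<Sum>m = 0..q - 2 * l. sqrt u ^ m / fact m *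
          ((-1) ^ (q - 2 * l - m) * T (Suc (q - 2 * l - m)) (sqrt u) / fact (q - 2 * l - m))))"
proof -
  let ?s = "sqrt u"
  let ?w = "\<lambda>y. exp (- (\<mu> \<bullet> y))"
  define \<Phi> where "\<Phi> = (\<lambda>s. LINT y|lborel. indicator (ball 0 s) y * (exp (- ((norm y)\<^sup>2 / 2)) * ?w y))"
  define F where "F r = 1 - K * \<Phi> (?s - r)" for r
  have s: "0 < ?s" using u by simp
  have d\<Phi>: "(\<Phi> has_real_derivative exp (- (s\<^sup>2 / 2)) * T 1 s) (at s)" if "0 < s" for s
    unfolding \<Phi>_def
  proof (rule has_derivative_gaussian_ball)
    \<comment> \<open>\<open>T 0\<close> agrees with the integral on a neighbourhood of \<open>s\<close>, so they have the same derivative there.\<close>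
    have "eventually (\<lambda>t. t \<in> {0<..}) (nhds s)"
      using that by (intro eventually_nhds_in_open) auto
    then have "eventually (\<lambda>t. T 0 t = (LINT y|lborel. indicator (ball 0 t) y * ?w y)) (nhds s)"
      by eventually_elim (simp add: T0)
    then show "((\<lambda>t. LINT y|lborel. indicator (ball 0 t) y * ?w y) has_real_derivative T 1 s) (at s)"
      using T[of 0 s] by (subst (asm) DERIV_cong_ev[OF refl _ refl]) auto
  qed (use that in \<open>auto intro!: continuous_intros\<close>)
  define f where "f r = K * exp (- (u / 2)) * (exp (- (r\<^sup>2 / 2)) * (exp (?s * r) * T 1 (?s - r)))" for r
  have small: "eventually (\<lambda>r. 0 < r \<and> r < ?s) (at_right 0)"
    using s by (auto simp: eventually_at_right_less eventually_at_right intro!: exI[of _ ?s])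
  have dF: "(F has_real_derivative f r) (at r)" if "r < ?s" for r
  proof -
    have "(F has_real_derivative K * (exp (- ((?s - r)\<^sup>2 / 2)) * T 1 (?s - r))) (at r)"
      unfolding F_def using that
      by (auto intro!: derivative_eq_intros DERIV_chain2[OF d\<Phi>])
    also have "exp (- ((?s - r)\<^sup>2 / 2)) = exp (- (u / 2)) * (exp (- (r\<^sup>2 / 2)) * exp (?s * r))"
      using u unfolding exp_add[symmetric] by (simp add: power2_diff field_simps)
    finally show ?thesis by (simp add: f_def mult_ac)
  qed
  have tube: "measure std_gaussian (tube (G \<mu> -` {u..}) r) = F r" if "0 < r" "r < ?s" for r
  proof -
    interpret prob_space "std_gaussian :: (real ^ 'k) measure"
      by (rule prob_space_std_gaussian)
    have "tube (G \<mu> -` {u..}) r = space std_gaussian - ball \<mu> (?s - r)"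
      using tube_outside_ball[OF u that] by auto
    then have "measure std_gaussian (tube (G \<mu> -` {u..}) r) = 1 - measure std_gaussian (ball \<mu> (?s - r))"
      by (simp only:) (rule prob_compl, simp)
    then show ?thesis
      by (simp add: measure_std_gaussian_ball F_def K_def \<Phi>_def)
  qed
  define b where "b n = (if even n then (- 1 / 2) ^ (n div 2) / fact (n div 2) else (0::real))" for n
  define t where "t e = (-1) ^ e * T (Suc e) ?s / fact e" for e
  have p1: "peano (\<lambda>r. exp (- (r\<^sup>2 / 2))) b q"
    unfolding b_def
  proof (rule peano_power_series, rule even_power_series)
    fix r :: real
    show "(\<lambda>i. (- 1 / 2) ^ i / fact i * r ^ (2 * i)) sums exp (- (r\<^sup>2 / 2))"
    proof -
      have "(- 1 / 2) ^ i / fact i * r ^ (2 * i) = ((- 1 / 2) * r\<^sup>2) ^ i /\<^sub>R fact i" for i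
        unfolding power_mult[of r 2 i]
        by (simp only: power_mult_distrib real_scaleR_def divide_inverse mult_ac)
      with exp_converges[of "(- 1 / 2) * r\<^sup>2"] show ?thesis by simp
    qed
  qed
  have p2: "peano (\<lambda>r. exp (?s * r)) (\<lambda>m. ?s ^ m / fact m) q"
    using exp_converges[of "?s * r" for r]
    by (intro peano_power_series) (simp add: power_mult_distrib divide_inverse mult_ac)
  have p3: "peano (\<lambda>r. T 1 (?s - r)) t q"
  proof -
    have "peano (\<lambda>r. (-1) ^ 0 * T (Suc 0) (?s - r)) (\<lambda>e. (-1) ^ e * T (Suc e) (?s - 0) / fact e) q"
      by (rule peano_Taylor[of "\<lambda>e r. (-1) ^ e * T (Suc e) (?s - r)"])
         (auto intro!: derivative_eq_intros DERIV_chain2[OF T])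
    then show ?thesis by (simp add: t_def[abs_def])
  qed
  define X where "X n = (\<Sum>p\<le>n. b p * (\<Sum>m\<le>n - p. ?s ^ m / fact m * t (n - p - m)))" for n
  \<comment> \<open>Expanding \<open>f\<close> only to order \<open>q\<close> suffices, as integration raises the order by one.\<close>
  have pf: "peano f (\<lambda>n. K * exp (- (u / 2)) * X n) q"
    unfolding f_def X_def by (intro peano_cmult peano_mult p1 p2 p3)
  define a where "a = case_nat (F 0) (\<lambda>n. K * exp (- (u / 2)) * X n / real (Suc n))"
  have "peano F a (Suc q)"
    unfolding a_def
  proof (rule peano_antiderivative)
    show "eventually (\<lambda>r. (F has_real_derivative f r) (at r)) (at_right 0)"
      using small by eventually_elim (simp add: dF)
    show "(F \<longlongrightarrow> F 0) (at_right 0)"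
      using DERIV_isCont[OF dF[of 0]] s by (simp add: isCont_def filterlim_at_split)
  qed (rule pf)
  moreover have "eventually (\<lambda>r. measure std_gaussian (tube (G \<mu> -` {u..}) r) = F r) (at_right 0)"
    using small by eventually_elim (simp add: tube)
  ultimately have expansion: "peano (\<lambda>r. measure std_gaussian (tube (G \<mu> -` {u..}) r)) a (Suc q)"
    by (simp add: peano_cong)
  have "X q = (\<Sum>p\<le>q. if even p then (- 1 / 2) ^ (p div 2) / fact (p div 2) *
      (\<Sum>m = 0..q - p. ?s ^ m / fact m * t (q - p - m)) else 0)"
    unfolding X_def b_def by (intro sum.cong) (auto simp: atLeast0AtMost)
  also have "\<dots> = (\<Sum>l = 0..q div 2. (- 1 / 2) ^ l / fact l *
      (\<Sum>m = 0..q - 2 * l. ?s ^ m / fact m * t (q - 2 * l - m)))"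
    by (rule sum_atMost_even)
  finally have "fact (Suc q) * a (Suc q) = K * exp (- (u / 2)) * fact q *
    (\<Sum>l = 0..q div 2. (- 1 / 2) ^ l / fact l *
      (\<Sum>m = 0..q - 2 * l. ?s ^ m / fact m * t (q - 2 * l - m)))"
    by (simp add: a_def)
  with expansion show thesis
    unfolding t_def by (rule that)
qed

theorem lemma5p1:
  fixes \<mu> :: "real ^ 'k" and u :: real and j :: nat
  assumes "j \<ge> 1" and "u > 0"
  shows "(\<exists>a. right_taylor_expansion (\<lambda>r. measure std_gaussian (tube (G \<mu> -` {u..}) r)) a j) \<and>
    (\<lambda>i. exp (- ((norm \<mu>)\<^sup>2 / 2)) * ((norm \<mu>) ^ (2 * i) / (2 ^ i * fact i))
        * (u powr ((real CARD('k) + 2 * real i - real j) / 2) * exp (- (u / 2))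
            / ((2 * pi) powr (real j / 2) * Gamma ((real CARD('k) + 2 * real i) / 2)
                * 2 powr ((real CARD('k) + 2 * real i - 2) / 2)))
        * (\<Sum>l = 0..(j - 1) div 2. \<Sum>m = 0..j - 1 - 2 * l.
             of_bool (int CARD('k) \<ge> int j - int m - 2 * int l - 2 * int i)
             * real ((CARD('k) + 2 * i - 1) choose (j - 1 - m - 2 * l))
             * ((-1) ^ (j - 1 + m + l) * fact (j - 1) / (fact m * fact l * 2 ^ l))
             * u ^ (m + l)))
    sums ec_density j (G \<mu>) u"
proof -
  define d where "d = CARD('k)"
  have d: "0 < d" by (simp add: d_def)
  define q where "q = j - 1"
  have j: "j = Suc q" using assms by (simp add: q_def)
  define s where "s = sqrt u"
  have s: "0 < s" "s\<^sup>2 = u" using assms by (simp_all add: s_def)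
  define c where "c = ball_coeff d (norm \<mu>)"
  have N: "(\<lambda>i. c i * x ^ (d + 2 * i)) sums (LINT y|lborel. indicator (ball 0 x) y * exp (- (\<mu> \<bullet> y)))"
    if "0 < x" for x
    using integral_ball_exp_sums[OF that, of \<mu>] by (simp add: c_def d_def)
  obtain T where T: "\<And>k s. (T k has_real_derivative T (Suc k) s) (at s)"
    "\<And>s. 0 < s \<Longrightarrow> T 0 s = (LINT y|lborel. indicator (ball 0 s) y * exp (- (\<mu> \<bullet> y)))"
    "\<And>k s. 0 < s \<Longrightarrow> (\<lambda>i. fact k * real ((d + 2 * i) choose k) * c i * s ^ (d + 2 * i - k)) sums T k s"
  proof (rule gap_series_derivatives)
    fix T :: "nat \<Rightarrow> real \<Rightarrow> real"
    assume "\<And>k s. (T k has_real_derivative T (Suc k) s) (at s)"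
      and "\<And>s. 0 < s \<Longrightarrow> T 0 s = (LINT y|lborel. indicator (ball 0 s) y * exp (- (\<mu> \<bullet> y)))"
      and "\<And>k s. 0 < s \<Longrightarrow> (\<lambda>i. fact k * real ((d + 2 * i) choose k) * c i * s ^ (d + 2 * i - k)) sums T k s"
    then show thesis by (rule that)
  qed (rule N)
  define E where "E = exp (- ((norm \<mu>)\<^sup>2 / 2))"
  define K where "K = (2 * pi) powr - (real d / 2) * E"
  obtain a where a: "peano (\<lambda>r. measure std_gaussian (tube (G \<mu> -` {u..}) r)) a j"
    "fact j * a j = K * exp (- (u / 2)) * fact q *
      (\<Sum>l = 0..q div 2. (- 1 / 2) ^ l / fact l *
        (\<Sum>m = 0..q - 2 * l. s ^ m / fact m *
          ((-1) ^ (q - 2 * l - m) * T (Suc (q - 2 * l - m)) s / fact (q - 2 * l - m))))"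
  proof (rule measure_tube_Taylor[OF assms(2) T(1,2), of q])
    fix a
    assume "peano (\<lambda>r. measure std_gaussian (tube (G \<mu> -` {u..}) r)) a (Suc q)"
      and "fact (Suc q) * a (Suc q) =
        (2 * pi) powr - (real CARD('k) / 2) * exp (- ((norm \<mu>)\<^sup>2 / 2)) * exp (- (u / 2)) * fact q *
        (\<Sum>l = 0..q div 2. (- 1 / 2) ^ l / fact l *
          (\<Sum>m = 0..q - 2 * l. sqrt u ^ m / fact m *
            ((-1) ^ (q - 2 * l - m) * T (Suc (q - 2 * l - m)) (sqrt u) / fact (q - 2 * l - m))))"
    then show thesis
      unfolding j[symmetric] s_def[symmetric] d_def[symmetric] E_def[symmetric] K_def[symmetric]
      by (rule that)
  qed
  have "\<exists>a. right_taylor_expansion (\<lambda>r. measure std_gaussian (tube (G \<mu> -` {u..}) r)) a j"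
    using a(1) by (intro exI[of _ "\<lambda>i. fact i * a i"]) (simp add: right_taylor_expansion_iff_peano)
  \<comment> \<open>\<open>\<tau> e i\<close> is the \<open>i\<close>-th term of the coefficient of $r^e$ in the expansion of $T_1(s - r)$.\<close>
  define \<tau> where "\<tau> e i = (-1) ^ e * (real ((d + 2 * i - 1) choose e) * (real (d + 2 * i) * c i) * s ^ (d + 2 * i - 1 - e))"
    for e i
  have \<tau>: "\<tau> e sums ((-1) ^ e * T (Suc e) s / fact e)" for e
  proof -
    have eq: "(-1) ^ e / fact e *
        (fact (Suc e) * real ((d + 2 * i) choose Suc e) * c i * s ^ (d + 2 * i - Suc e)) = \<tau> e i" for i
    proof -
      obtain n where n: "d + 2 * i = Suc n" using d by (cases "d + 2 * i") auto
      have "real (Suc e) * real (Suc n choose Suc e) = real (Suc n) * real (n choose e)"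
        using Suc_times_binomial[of e n] by (metis of_nat_mult)
      then have "(-1) ^ e / fact e * (fact (Suc e) * real (Suc n choose Suc e) * c i * s ^ (Suc n - Suc e)) =
         (-1) ^ e * (real (n choose e) * (real (Suc n) * c i) * s ^ (n - e))"
        by (simp add: mult_ac del: of_nat_Suc binomial_Suc_Suc)
      then show ?thesis by (simp add: n \<tau>_def del: of_nat_Suc binomial_Suc_Suc fact_Suc)
    qed
    show ?thesis
      using sums_mult[OF T(3)[OF s(1), of "Suc e"], of "(-1) ^ e / fact e"]
      unfolding eq by (simp add: mult_ac)
  qed
  have "(\<lambda>i. (2 * pi) powr (- (real j / 2)) * (K * exp (- (u / 2)) * fact q *
      (\<Sum>l = 0..q div 2. (- 1 / 2) ^ l / fact l *
        (\<Sum>m = 0..q - 2 * l. s ^ m / fact m * \<tau> (q - 2 * l - m) i))))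
      sums ((2 * pi) powr (- (real j / 2)) * (fact j * a j))"
    unfolding a(2) by (intro sums_mult sums_sum \<tau>)
  also have "(2 * pi) powr (- (real j / 2)) * (fact j * a j) = ec_density j (G \<mu>) u"
    using right_taylor_coeff_eq[OF a(1)] by (simp add: ec_density_def gaussian_minkowski_def)
  also have "(\<lambda>i. (2 * pi) powr (- (real j / 2)) * (K * exp (- (u / 2)) * fact q *
      (\<Sum>l = 0..q div 2. (- 1 / 2) ^ l / fact l *
        (\<Sum>m = 0..q - 2 * l. s ^ m / fact m * \<tau> (q - 2 * l - m) i)))) =
    (\<lambda>i. E * ((norm \<mu>) ^ (2 * i) / (2 ^ i * fact i))
        * (u powr ((real d + 2 * real i - real j) / 2) * exp (- (u / 2))
            / ((2 * pi) powr (real j / 2) * Gamma ((real d + 2 * real i) / 2)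
                * 2 powr ((real d + 2 * real i - 2) / 2)))
        * (\<Sum>l = 0..q div 2. \<Sum>m = 0..q - 2 * l.
             of_bool (int d \<ge> int j - int m - 2 * int l - 2 * int i)
             * real ((d + 2 * i - 1) choose (q - m - 2 * l))
             * ((-1) ^ (q + m + l) * fact q / (fact m * fact l * 2 ^ l))
             * u ^ (m + l)))" (is "?L = ?R")
  proof
    fix i
    define P where "P = u powr ((real d + 2 * real i - real j) / 2)"
    define A where "A = (2 * pi) powr (- (real j / 2)) * (K * exp (- (u / 2)))"
    define B where "B = real (d + 2 * i) * c i"
    let ?t = "\<lambda>l m. of_bool (int d \<ge> int j - int m - 2 * int l - 2 * int i)
             * real ((d + 2 * i - 1) choose (q - m - 2 * l))
             * ((-1) ^ (q + m + l) * fact q / (fact m * fact l * 2 ^ l)) * u ^ (m + l)"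
    have KB: "A * B * P = E * ((norm \<mu>) ^ (2 * i) / (2 ^ i * fact i)) * (P * exp (- (u / 2))
            / ((2 * pi) powr (real j / 2) * Gamma ((real d + 2 * real i) / 2)
                * 2 powr ((real d + 2 * real i - 2) / 2)))"
    proof -
      have "A * B * P = (2 * pi) powr (- (real j / 2)) * E * exp (- (u / 2)) * P *
         ((2 * pi) powr - (real d / 2) * (real (d + 2 * i) * ball_coeff d (norm \<mu>) i))"
        by (simp add: A_def B_def K_def c_def mult_ac)
      then show ?thesis
        unfolding ball_coeff_times_degree[OF d]
        by (simp only: powr_minus divide_inverse inverse_mult_distrib mult_ac)
    qed
    have summand: "fact q * ((- 1 / 2) ^ l / fact l * (s ^ m / fact m * \<tau> (q - 2 * l - m) i)) = B * P * ?t l m"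
      if l: "l \<in> {0..q div 2}" and m: "m \<in> {0..q - 2 * l}" for l m
    proof -
      define e where "e = q - m - 2 * l"
      have e: "q - 2 * l - m = e" "q = e + m + 2 * l"
        using l m by (auto simp: e_def)
      show ?thesis
      proof (cases "e \<le> d + 2 * i - 1")
        case True
        \<comment> \<open>The exponent of \<open>s\<close> in \<open>\<tau> e i\<close>; in the other case the binomial coefficient vanishes.\<close>
        define n where "n = d + 2 * i - 1 - e"
        have n: "d + 2 * i = Suc (n + e)" using True d by (simp add: n_def)
        have rn: "real d + 2 * real i - real j = real n - real m - 2 * real l"
          using n e(2) j by linarith
        have "s ^ m * s ^ n = s powr (real m + real n)"
          using s by (simp add: powr_realpow powr_add)
        also have "\<dots> = s powr (real n - real m - 2 * real l) * s powr (2 * real (m + l))"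
          using s by (simp flip: powr_add)
        also have "s powr (2 * real (m + l)) = (s powr 2) powr real (m + l)"
          by (rule powr_powr[symmetric])
        also have "\<dots> = u ^ (m + l)"
          using s assms(2) by (simp add: powr_realpow del: of_nat_add)
        also have "s powr (real n - real m - 2 * real l) = P"
        proof -
          have half: "s = u powr (1 / 2)" using assms(2) by (simp add: s_def powr_half_sqrt)
          show ?thesis unfolding P_def rn half powr_powr by simp
        qed
        finally have pow: "s ^ m * s ^ n = P * u ^ (m + l)" .
        have sign: "(- 1 / 2) ^ l * (-1) ^ e = ((-1) ^ (q + m + l) / 2 ^ l :: real)"
        proof -
          have "q + m + l = e + l + 2 * (m + l)" using e(2) by simp
          then have "(-1) ^ (q + m + l) = ((-1) ^ (e + l) :: real)"
            by (simp only: power_add power_mult power2_minus power_one mult_1_right)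
          then show ?thesis by (simp only: power_divide power_add times_divide_eq_left times_divide_eq_right mult.commute)
        qed
        have ind: "int d \<ge> int j - int m - 2 * int l - 2 * int i"
          using n e(2) j by linarith
        have "fact q * ((- 1 / 2) ^ l / fact l * (s ^ m / fact m * \<tau> e i)) =
           fact q / (fact l * fact m) * ((- 1 / 2) ^ l * (-1) ^ e) *
             real ((d + 2 * i - 1) choose e) * B * (s ^ m * s ^ n)"
          by (simp add: \<tau>_def B_def n_def mult_ac)
        also have "\<dots> = B * P * ?t l m"
          unfolding pow sign e_def[symmetric] using ind by (simp add: mult_ac)
        finally show ?thesis unfolding e(1) .
      next
        case False
        then have zero: "(d + 2 * i - 1) choose e = 0" by (intro binomial_eq_0) simp
        show ?thesis unfolding e(1) \<tau>_def e_def[symmetric] zero by simp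
      qed
    qed
    have "?L i = A * (\<Sum>l = 0..q div 2. \<Sum>m = 0..q - 2 * l.
        fact q * ((- 1 / 2) ^ l / fact l * (s ^ m / fact m * \<tau> (q - 2 * l - m) i)))"
      by (simp add: A_def sum_distrib_left mult.assoc)
    also have "\<dots> = A * (\<Sum>l = 0..q div 2. \<Sum>m = 0..q - 2 * l. B * P * ?t l m)"
      by (intro arg_cong[of _ _ "(*) A"] sum.cong refl summand)
    also have "\<dots> = A * B * P * (\<Sum>l = 0..q div 2. \<Sum>m = 0..q - 2 * l. ?t l m)"
      by (simp only: sum_distrib_left[symmetric] mult.assoc)
    also have "\<dots> = ?R i"
      unfolding KB by (simp only: P_def)
    finally show "?L i = ?R i" .
  qed
  finally show ?thesis
    using \<open>\<exists>a. right_taylor_expansion _ a j\<close> unfolding E_def d_def q_def by blast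
qed

end
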